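(* For all $\gamma_0,t\in[0,1]$, there exist a closed set $G\subset[0,1]$ with $\dim_{\mathrm H}(G)=t$ and $\dim_{\mathrm P}(G)=1$, and a limsup random fractal $A\subset[0,1]$ (on some probability space $(\Omega,\mathscr{B},\mathbb{P})$) with indices $\gamma_1=\gamma_2=\gamma_0$ and satisfying the Correlation Condition with constant $\delta=0$, such that $\dim_{\mathrm H}(A\cap G)=\min\{t,1-\gamma_0\}$ almost surely.
   Context: $\dim_{\mathrm H}$ and $\dim_{\mathrm P}$ denote Hausdorff and packing dimension, with the usual convention that the empty set has dimension $0$. For $n\ge 0$, $\mathcal{Q}_n=\{[k2^{-n},(k+1)2^{-n}] : k\in\mathbb{Z},\ 0\le k\le 2^n-1\}$ is the collection of closed dyadic intervals of order $n$ in $[0,1]$. Limsup random fractal: for $n\ge 1$ let $\{Z_n(Q): Q\in\mathcal{Q}_n\}$ be random variables, all defined on one probability space $(\Omega,\mathscr{B},\mathbb{P})$ and taking values in $\{0,1\}$. Put $A(n)=\bigcup_{Q\in\mathcal{Q}_n,\ Z_n(Q)=1}Q$ and $A=\limsup_{n\to\infty}A(n)=\bigcap_{k\ge1}\bigcup_{n\ge k}A(n)$. The random set $A$ is called the limsup random fractal associated to $\{Z_n(Q): n\ge1, Q\in\mathcal{Q}_n\}$. Indices: with $P_n(Q)=\mathbb{P}(Z_n(Q)=1)$ and the convention $\log_2 0=-\infty$, \[\gamma_1=-\limsup_{n\to\infty}\frac{\log_2(\max_{Q\in\mathcal{Q}_n}P_n(Q))}{n},\qquad \gamma_2=-\limsup_{n\to\infty}\frac{\log_2(\min_{Q\in\mathcal{Q}_n}P_n(Q))}{n}.\]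 Correlation Condition with constant $\delta\ge0$: for all $\epsilon>0$, $\limsup_{n\to\infty}\frac1n\log_2 f(n,\epsilon)\le\delta$, where \[f(n,\epsilon)=\max_{Q\in\mathcal{Q}_n}\#\{Q'\in\mathcal{Q}_n : \mathrm{Cov}(Z_n(Q),Z_n(Q'))\ge\epsilon P_n(Q)P_n(Q')\}\] and $\mathrm{Cov}$ denotes covariance. *)

theory Defs
  imports "HOL-Probability.Probability"
begin

section \<open>Hausdorff dimension\<close>

text \<open>
  The usual conventions for the exponent \<open>0\<close> are \<open>|U|^0 = 1\<close> for nonempty \<open>U\<close> and \<open>|{}|^s = 0\<close>;
  they are spelled out since \<open>0 powr 0 = 0\<close> in HOL.
\<close>
definition diam_powr :: "real \<Rightarrow> 'a::metric_space set \<Rightarrow> ennreal" where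
  "diam_powr s U = (if U = {} then 0 else if s = 0 then 1 else ennreal (diameter U powr s))"

text \<open>Boundedness is required because \<^const>\<open>diameter\<close> is real-valued, hence meaningless on unbounded sets.\<close>
definition hausdorff_content :: "real \<Rightarrow> real \<Rightarrow> 'a::metric_space set \<Rightarrow> ennreal" where
  "hausdorff_content s d E =
     (INF U \<in> {U :: nat \<Rightarrow> 'a set. E \<subseteq> (\<Union>i. U i) \<and> (\<forall>i. bounded (U i) \<and> diameter (U i) \<le> d)}.
        (\<Sum>i. diam_powr s (U i)))"

definition hausdorff_measure :: "real \<Rightarrow> 'a::metric_space set \<Rightarrow> ennreal" where
  "hausdorff_measure s E = (SUP d \<in> {0<..}. hausdorff_content s d E)"

definition hausdorff_dim :: "'a::metric_space set \<Rightarrow> ereal" where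
  "hausdorff_dim E = Inf (ereal ` {s. 0 \<le> s \<and> hausdorff_measure s E = 0})"


section \<open>Packing dimension\<close>

text \<open>A packing is given by its pairs (centre, radius); a closed ball of radius \<open>r\<close> has diameter \<open>2 r\<close>.\<close>
definition packings :: "real \<Rightarrow> 'a::euclidean_space set \<Rightarrow> ('a \<times> real) set set" where
  "packings d E =
     {B. countable B \<and> B \<subseteq> E \<times> {0<..d} \<and> disjoint_family_on (\<lambda>(x, r). cball x r) B}"

definition packing_content :: "real \<Rightarrow> real \<Rightarrow> 'a::euclidean_space set \<Rightarrow> ennreal" where
  "packing_content s d E = (SUP B \<in> packings d E. (\<Sum>\<^sub>\<infinity>(x, r)\<in>B. ennreal ((2 * r) powr s)))"

definition packing_premeasure :: "real \<Rightarrow> 'a::euclidean_space set \<Rightarrow> ennreal" where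
  "packing_premeasure s E = (INF d \<in> {0<..}. packing_content s d E)"

definition packing_measure :: "real \<Rightarrow> 'a::euclidean_space set \<Rightarrow> ennreal" where
  "packing_measure s E =
     (INF F \<in> {F :: nat \<Rightarrow> 'a set. E \<subseteq> (\<Union>i. F i)}. (\<Sum>i. packing_premeasure s (F i)))"

definition packing_dim :: "'a::euclidean_space set \<Rightarrow> ereal" where
  "packing_dim E = Inf (ereal ` {s. 0 \<le> s \<and> packing_measure s E = 0})"


section \<open>Limsup random fractals\<close>

definition dyadic_intervals :: "nat \<Rightarrow> real set set" where
  "dyadic_intervals n =
     {{of_int k / 2 ^ n .. (of_int k + 1) / 2 ^ n} | k :: int. 0 \<le> k \<and> k \<le> 2 ^ n - 1}"

locale limsup_random_fractal = prob_space M for M :: "'w measure" +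
  fixes Z :: "nat \<Rightarrow> real set \<Rightarrow> 'w \<Rightarrow> real"
  assumes Z_measurable:
      "n \<ge> 1 \<Longrightarrow> Q \<in> dyadic_intervals n \<Longrightarrow> random_variable borel (Z n Q)"
    and Z_values:
      "n \<ge> 1 \<Longrightarrow> Q \<in> dyadic_intervals n \<Longrightarrow> \<omega> \<in> space M \<Longrightarrow> Z n Q \<omega> \<in> {0, 1}"

definition fractal_level :: "(nat \<Rightarrow> real set \<Rightarrow> 'w \<Rightarrow> real) \<Rightarrow> nat \<Rightarrow> 'w \<Rightarrow> real set" where
  "fractal_level Z n \<omega> = \<Union>{Q \<in> dyadic_intervals n. Z n Q \<omega> = 1}"

definition limsup_fractal :: "(nat \<Rightarrow> real set \<Rightarrow> 'w \<Rightarrow> real) \<Rightarrow> 'w \<Rightarrow> real set" where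
  "limsup_fractal Z \<omega> = (\<Inter>k\<in>{1..}. \<Union>n\<in>{k..}. fractal_level Z n \<omega>)"

definition hit_prob :: "'w measure \<Rightarrow> (nat \<Rightarrow> real set \<Rightarrow> 'w \<Rightarrow> real) \<Rightarrow> nat \<Rightarrow> real set \<Rightarrow> real" where
  "hit_prob M Z n Q = measure M {\<omega> \<in> space M. Z n Q \<omega> = 1}"

text \<open>Only used for nonnegative arguments, with \<open>log2 0 = -\<infinity>\<close>.\<close>
definition elog2 :: "real \<Rightarrow> ereal" where
  "elog2 x = (if x \<le> 0 then -\<infinity> else ereal (log 2 x))"

definition index_gamma1 :: "'w measure \<Rightarrow> (nat \<Rightarrow> real set \<Rightarrow> 'w \<Rightarrow> real) \<Rightarrow> ereal" where
  "index_gamma1 M Z =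
     - limsup (\<lambda>n. elog2 (MAX Q\<in>dyadic_intervals n. hit_prob M Z n Q) / ereal (real n))"

definition index_gamma2 :: "'w measure \<Rightarrow> (nat \<Rightarrow> real set \<Rightarrow> 'w \<Rightarrow> real) \<Rightarrow> ereal" where
  "index_gamma2 M Z =
     - limsup (\<lambda>n. elog2 (MIN Q\<in>dyadic_intervals n. hit_prob M Z n Q) / ereal (real n))"

definition covariance :: "'w measure \<Rightarrow> ('w \<Rightarrow> real) \<Rightarrow> ('w \<Rightarrow> real) \<Rightarrow> real" where
  "covariance M X Y =
     (\<integral>\<omega>. (X \<omega> - (\<integral>\<omega>'. X \<omega>' \<partial>M)) * (Y \<omega> - (\<integral>\<omega>'. Y \<omega>' \<partial>M)) \<partial>M)"

definition corr_count ::
    "'w measure \<Rightarrow> (nat \<Rightarrow> real set \<Rightarrow> 'w \<Rightarrow> real) \<Rightarrow> nat \<Rightarrow> real \<Rightarrow> nat" where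
  "corr_count M Z n \<epsilon> =
     (MAX Q\<in>dyadic_intervals n.
        card {Q' \<in> dyadic_intervals n.
                covariance M (Z n Q) (Z n Q') \<ge> \<epsilon> * hit_prob M Z n Q * hit_prob M Z n Q'})"

definition correlation_condition ::
    "'w measure \<Rightarrow> (nat \<Rightarrow> real set \<Rightarrow> 'w \<Rightarrow> real) \<Rightarrow> real \<Rightarrow> bool" where
  "correlation_condition M Z \<delta> \<longleftrightarrow>
     (\<forall>\<epsilon>>0. limsup (\<lambda>n. elog2 (real (corr_count M Z n \<epsilon>)) / ereal (real n)) \<le> ereal \<delta>)"

end

theory Submission
  imports Defs
begin

text \<open>
  Put \<open>c = 1 - \<gamma>\<^sub>0\<close> and \<open>a = \<lceil>c n\<rceil>\<close>. Inside every dyadic interval of order \<open>a\<close> one subinterval of order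
  \<open>n\<close> is selected uniformly at random, independently of the others. All hitting probabilities of order
  \<open>n\<close> are then \<open>2\<^sup>a\<^sup>-\<^sup>n\<close>, distinct intervals are never positively correlated, and the number of selected
  intervals is always \<open>2\<^sup>a\<close>, so the limsup set has dimension at most \<open>c\<close> for every outcome. The set \<open>G\<close>
  consists of the points whose binary digits are free on the even ones of the blocks \<open>[k!, (k + 1)!)\<close>
  and free with density \<open>t\<close>, otherwise zero, on the odd ones.

  The lower bound also holds for every outcome: since \<open>G\<close> imposes no condition on an even block ending
  at \<open>n = (k + 1)!\<close>, the digits from \<open>a\<close> to \<open>n\<close> can be used to steer a point of \<open>G\<close> into a selected
  interval, at the cost of losing these digits. The points obtained in this way are parametrised by
  \<open>[0, 1)\<close>, and the mass distribution principle is applied to the image of Lebesgue measure.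
\<close>

section \<open>Hausdorff and packing dimension\<close>

lemma ereal_Inf_le:
  assumes "\<And>s. a < s \<Longrightarrow> P s"
  shows "Inf (ereal ` {s. P s}) \<le> ereal a"
proof (rule ereal_le_epsilon2)
  fix e :: real
  assume "0 < e"
  then have "ereal (a + e) \<in> ereal ` {s. P s}"
    using assms by auto
  then show "Inf (ereal ` {s. P s}) \<le> ereal a + ereal e"
    by (simp add: Inf_lower)
qed

lemma hausdorff_dim_le:
  assumes "0 \<le> a" and "\<And>s. a < s \<Longrightarrow> hausdorff_measure s E = 0"
  shows "hausdorff_dim E \<le> ereal a"
  unfolding hausdorff_dim_def using assms by (intro ereal_Inf_le) auto

lemma hausdorff_dim_ge:
  assumes "\<And>s. 0 \<le> s \<Longrightarrow> s < a \<Longrightarrow> hausdorff_measure s E \<noteq> 0"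
  shows "ereal a \<le> hausdorff_dim E"
  unfolding hausdorff_dim_def using assms by (intro Inf_greatest) (force simp: not_less)

lemma hausdorff_content_mono:
  assumes "E \<subseteq> F"
  shows "hausdorff_content s d E \<le> hausdorff_content s d F"
  unfolding hausdorff_content_def using assms by (intro INF_superset_mono) auto

lemma hausdorff_measure_mono:
  assumes "E \<subseteq> F"
  shows "hausdorff_measure s E \<le> hausdorff_measure s F"
  unfolding hausdorff_measure_def using assms by (intro SUP_mono') (rule hausdorff_content_mono)

lemma hausdorff_dim_mono:
  assumes "E \<subseteq> F"
  shows "hausdorff_dim E \<le> hausdorff_dim F"
  unfolding hausdorff_dim_def
proof (intro Inf_superset_mono image_mono Collect_mono impI)
  fix s assume "0 \<le> s \<and> hausdorff_measure s F = 0"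
  then show "0 \<le> s \<and> hausdorff_measure s E = 0"
    using hausdorff_measure_mono[OF assms, of s] by (metis le_zero_eq)
qed

lemma packing_dim_le:
  assumes "0 \<le> a" and "\<And>s. a < s \<Longrightarrow> packing_measure s E = 0"
  shows "packing_dim E \<le> ereal a"
  unfolding packing_dim_def using assms by (intro ereal_Inf_le) auto

lemma packing_dim_ge:
  assumes "\<And>s. 0 \<le> s \<Longrightarrow> s < a \<Longrightarrow> packing_measure s E \<noteq> 0"
  shows "ereal a \<le> packing_dim E"
  unfolding packing_dim_def using assms by (intro Inf_greatest) (force simp: not_less)

text \<open>Powers of a number in [0, 1] decrease in the exponent. Exponent 0 is treated apart
  because \<open>diam_powr\<close> is then 1 on every nonempty set by convention, even at diameter
  0.\<close>

lemma diam_powr_mono_exponent: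
  assumes "0 \<le> s" "s \<le> s'" "0 < s'" "bounded U" "diameter U \<le> 1"
  shows "diam_powr s' U \<le> diam_powr s U"
proof (cases "s = 0")
  case True
  have "diameter U powr s' \<le> 1 powr s'"
    using assms by (intro powr_mono2) (auto simp: diameter_ge_0)
  then show ?thesis
    using True assms by (auto simp: diam_powr_def ennreal_le_1)
next
  case False
  have "diameter U powr s' \<le> diameter U powr s"
    using assms by (intro powr_mono') (auto simp: diameter_ge_0)
  then show ?thesis
    using False assms by (auto simp: diam_powr_def intro!: ennreal_leI)
qed

section \<open>Covers and packings that force a measure to vanish\<close>

text \<open>A Borel-Cantelli argument: every tail of the covers still covers \<open>E\<close>, late
  tails consist of small sets, and their cost is a tail of a convergent series.\<close>

lemma hausdorff_measure_limsup_cover: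
  fixes V :: "nat \<Rightarrow> 'i::countable \<Rightarrow> 'a::metric_space set"
  assumes cover: "\<And>k. E \<subseteq> (\<Union>n\<in>{k..}. \<Union>x\<in>T n. V n x)"
    and fin: "\<And>n. finite (T n)"
    and bdd: "\<And>n x. x \<in> T n \<Longrightarrow> bounded (V n x)"
    and diam: "\<And>n x. x \<in> T n \<Longrightarrow> diameter (V n x) \<le> r n"
    and r: "r \<longlonglongrightarrow> 0"
    and sm: "summable (\<lambda>n. card (T n) * r n powr s)"
    and s: "0 < s"
  shows "hausdorff_measure s E = 0"
proof -
  have "hausdorff_content s d E \<le> ennreal e" if "0 < d" "0 < e" for d e
  proof -
    let ?f = "\<lambda>n. card (T n) * r n powr s"
    obtain k1 where k1: "\<And>n. n \<ge> k1 \<Longrightarrow> r n < d"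
      using order_tendstoD(2)[OF r \<open>0 < d\<close>] by (auto simp: eventually_sequentially)
    obtain k2 where k2: "\<And>n. n \<ge> k2 \<Longrightarrow> norm (\<Sum>i. ?f (i + n)) < e"
      using suminf_exist_split[OF \<open>0 < e\<close> sm] by auto
    define k where "k = max k1 k2"
    define W where "W = (\<lambda>(n, i). if i \<in> to_nat ` T (n + k) then V (n + k) (from_nat i) else {})"
    define U where "U i = W (prod_decode i)" for i
    have W: "bounded (W p) \<and> diameter (W p) \<le> d" for p
    proof (cases p)
      case (Pair n i)
      have "r (n + k) < d"
        by (rule k1) (simp add: k_def)
      then show ?thesis
        using diam[of _ "n + k"] bdd[of _ "n + k"] \<open>0 < d\<close> by (force simp: W_def Pair)
    qed
    have "E \<subseteq> (\<Union>i. U i)"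
    proof
      fix y assume "y \<in> E"
      then obtain n x where nx: "n \<ge> k" "x \<in> T n" "y \<in> V n x"
        using cover[of k] by blast
      then have "y \<in> W (n - k, to_nat x)"
        by (auto simp: W_def)
      then have "y \<in> U (prod_encode (n - k, to_nat x))"
        by (simp add: U_def)
      then show "y \<in> (\<Union>i. U i)" by blast
    qed
    then have "hausdorff_content s d E \<le> (\<Sum>i. diam_powr s (U i))"
      unfolding hausdorff_content_def using W by (intro INF_lower) (auto simp: U_def)
    also have "\<dots> = (\<Sum>n. \<Sum>i. diam_powr s (W (n, i)))"
      unfolding U_def by (rule suminf_ennreal_2dimen) simp
    also have "\<dots> \<le> (\<Sum>n. ennreal (?f (n + k)))"
    proof (rule suminf_le)
      fix n
      have "(\<Sum>i. diam_powr s (W (n, i))) = (\<Sum>i\<in>to_nat ` T (n + k). diam_powr s (W (n, i)))"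
        using fin by (intro suminf_finite) (auto simp: W_def diam_powr_def)
      also have "\<dots> \<le> (\<Sum>i\<in>to_nat ` T (n + k). ennreal (r (n + k) powr s))"
      proof (rule sum_mono)
        fix i assume "i \<in> to_nat ` T (n + k)"
        then obtain x where x: "x \<in> T (n + k)" "i = to_nat x" by auto
        have "diameter (V (n + k) x) powr s \<le> r (n + k) powr s"
          using x s by (intro powr_mono2 diam diameter_ge_0 bdd) auto
        then show "diam_powr s (W (n, i)) \<le> ennreal (r (n + k) powr s)"
          using s x by (auto simp: diam_powr_def W_def intro: ennreal_leI)
      qed
      also have "\<dots> = ennreal (?f (n + k))"
        by (simp add: card_image inj_on_subset[OF inj_to_nat] ennreal_mult' ennreal_of_nat_eq_real_of_nat)
      finally show "(\<Sum>i. diam_powr s (W (n, i))) \<le> ennreal (?f (n + k))" .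
    qed auto
    also have "\<dots> = ennreal (\<Sum>n. ?f (n + k))"
      using sm by (intro suminf_ennreal2) (auto simp: summable_iff_shift[of ?f k])
    also have "\<dots> \<le> ennreal e"
      using k2[of k] by (intro ennreal_leI) (auto simp: k_def)
    finally show ?thesis .
  qed
  then have "hausdorff_content s d E = 0" if "0 < d" for d
    using that ennreal_le_epsilon[of 0 "hausdorff_content s d E"]
    by (metis add_0 le_zero_eq)
  then show ?thesis
    by (simp add: hausdorff_measure_def)
qed

text \<open>Comparison with length: the disjoint balls fit into [-d, 1 + d], so their diameters sum
  to at most 1 + 2d, and each \<open>(2 * r) powr s\<close> is at most
  \<open>(2 * d) powr (s - 1)\<close> times the diameter.\<close>

lemma packing_content_le:
  fixes E :: "real set"
  assumes "E \<subseteq> {0..1}" "0 < d" "1 \<le> s"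
  shows "packing_content s d E \<le> ennreal ((2 * d) powr (s - 1) * (1 + 2 * d))"
  unfolding packing_content_def
proof (rule SUP_least)
  fix B assume "B \<in> packings d E"
  then have B: "B \<subseteq> E \<times> {0<..d}" "disjoint_family_on (\<lambda>(x, r). cball x r) B"
    by (auto simp: packings_def)
  show "(\<Sum>\<^sub>\<infinity>(x, r)\<in>B. ennreal ((2 * r) powr s)) \<le> ennreal ((2 * d) powr (s - 1) * (1 + 2 * d))"
    unfolding nonneg_infsum_complete[OF zero_le]
  proof (rule SUP_least, clarify)
    fix S assume S: "finite S" "S \<subseteq> B"
    have "(\<Sum>(x, r)\<in>S. ennreal (2 * r)) = (\<Sum>p\<in>S. emeasure lborel (case p of (x, r) \<Rightarrow> cball x r))"
    proof (rule sum.cong[OF refl], clarify)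
      fix x r assume "(x, r) \<in> S"
      then have "0 < r" using S B(1) by auto
      then show "ennreal (2 * r) = emeasure lborel (cball x r)"
        by (simp add: cball_eq_atLeastAtMost)
    qed
    also have "\<dots> = emeasure lborel (\<Union>p\<in>S. case p of (x, r) \<Rightarrow> cball x r)"
      by (intro sum_emeasure disjoint_family_on_mono[OF S(2) B(2)] S(1)) (simp add: image_subset_iff case_prod_unfold)
    also have "\<dots> \<le> emeasure lborel {- d..1 + d}"
    proof (rule emeasure_mono)
      show "(\<Union>p\<in>S. case p of (x, r) \<Rightarrow> cball x r) \<subseteq> {- d..1 + d}"
      proof clarify
        fix x r y assume xr: "(x, r) \<in> S" and y: "y \<in> cball x r"
        from xr have "(x, r) \<in> E \<times> {0<..d}"
          using S(2) B(1) by blast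
        then have "x \<in> {0..1}" "r \<le> d"
          using assms(1) by auto
        with y show "y \<in> {- d..1 + d}"
          by (auto simp: cball_eq_atLeastAtMost)
      qed
    qed simp
    also have "\<dots> = ennreal (1 + 2 * d)"
      using \<open>0 < d\<close> by (simp add: algebra_simps)
    finally have area: "(\<Sum>(x, r)\<in>S. ennreal (2 * r)) \<le> ennreal (1 + 2 * d)" .
    have "(\<Sum>(x, r)\<in>S. ennreal ((2 * r) powr s)) \<le> (\<Sum>(x, r)\<in>S. ennreal ((2 * d) powr (s - 1)) * ennreal (2 * r))"
    proof (rule sum_mono, clarify)
      fix x r assume "(x, r) \<in> S"
      then have r: "0 < r" "r \<le> d" using S B by auto
      have "(2 * r) powr s = (2 * r) powr (s - 1) * (2 * r)"
        using r by (simp add: powr_diff)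
      also have "\<dots> \<le> (2 * d) powr (s - 1) * (2 * r)"
        using r assms by (intro mult_right_mono powr_mono2) auto
      finally show "ennreal ((2 * r) powr s) \<le> ennreal ((2 * d) powr (s - 1)) * ennreal (2 * r)"
        using r by (subst ennreal_mult[symmetric]) (auto intro: ennreal_leI)
    qed
    also have "\<dots> = ennreal ((2 * d) powr (s - 1)) * (\<Sum>(x, r)\<in>S. ennreal (2 * r))"
      by (simp add: sum_distrib_left case_prod_unfold)
    also have "\<dots> \<le> ennreal ((2 * d) powr (s - 1)) * ennreal (1 + 2 * d)"
      by (intro mult_left_mono area) simp
    also have "\<dots> = ennreal ((2 * d) powr (s - 1) * (1 + 2 * d))"
      using \<open>0 < d\<close> by (subst ennreal_mult) auto
    finally show "(\<Sum>(x, r)\<in>S. ennreal ((2 * r) powr s)) \<le> ennreal ((2 * d) powr (s - 1) * (1 + 2 * d))" .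
  qed
qed

lemma packing_premeasure_empty [simp]: "packing_premeasure s ({} :: 'a::euclidean_space set) = 0"
proof -
  have "packing_content s d ({} :: 'a set) = 0" for d
    by (simp add: packing_content_def packings_def disjoint_family_on_def bot_ennreal)
  then have "packing_premeasure s ({} :: 'a set) = (INF d \<in> {0<..} :: real set. 0)"
    by (simp add: packing_premeasure_def)
  also have "\<dots> = 0"
    by (rule cINF_const) auto
  finally show ?thesis .
qed

lemma packing_measure_le_premeasure: "packing_measure s E \<le> packing_premeasure s E"
proof -
  let ?F = "\<lambda>i::nat. if i = 0 then E else {}"
  have "packing_measure s E \<le> (\<Sum>i. packing_premeasure s (?F i))"
    unfolding packing_measure_def by (rule INF_lower) (auto split: if_splits)
  also have "\<dots> = (\<Sum>i\<in>{0}. packing_premeasure s (?F i))"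
    by (rule suminf_finite) auto
  finally show ?thesis by simp
qed

text \<open>For \<open>1 < s\<close> the content bound tends to 0 with the scale, so the premeasure
  vanishes.\<close>

lemma packing_dim_le_1:
  fixes E :: "real set"
  assumes "E \<subseteq> {0..1}"
  shows "packing_dim E \<le> 1"
proof -
  have "packing_measure s E = 0" if "1 < s" for s
  proof -
    let ?f = "\<lambda>d. (2 * d) powr (s - 1) * (1 + 2 * d)"
    have lim2: "((\<lambda>d. 2 * d) \<longlongrightarrow> (0 :: real)) (at_right 0)"
      by (rule tendsto_mult_right_zero) (rule tendsto_ident_at)
    then have "((\<lambda>d. (2 * d) powr (s - 1)) \<longlongrightarrow> 0) (at_right 0)"
      using that by (intro tendsto_zero_powrI[where b = "s - 1"]) (auto intro: eventually_at_rightI[of 0 1])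
    from tendsto_mult[OF this tendsto_add[OF tendsto_const[of 1] lim2]]
    have "(?f \<longlongrightarrow> 0) (at_right 0)" by simp
    then have lim: "((\<lambda>d. ennreal (?f d)) \<longlongrightarrow> 0) (at_right 0)"
      using tendsto_ennrealI by fastforce
    have "eventually (\<lambda>d. packing_premeasure s E \<le> ennreal (?f d)) (at_right 0)"
    proof (rule eventually_at_rightI[of 0 1])
      fix d :: real assume d: "d \<in> {0<..<1}"
      have "packing_premeasure s E \<le> packing_content s d E"
        unfolding packing_premeasure_def using d by (intro INF_lower) auto
      also have "\<dots> \<le> ennreal (?f d)"
        using d that assms by (intro packing_content_le) auto
      finally show "packing_premeasure s E \<le> ennreal (?f d)" .
    qed simp
    then have "packing_premeasure s E \<le> 0"
      by (intro tendsto_lowerbound[OF lim]) auto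
    then show ?thesis
      using packing_measure_le_premeasure[of s E] by simp
  qed
  then show ?thesis
    using packing_dim_le[of 1 E] by (simp add: one_ereal_def)
qed

section \<open>Points with prescribed binary digits\<close>

definition dyad :: "nat \<Rightarrow> nat \<Rightarrow> real set" where
  "dyad n p = {real p / 2 ^ n .. (real p + 1) / 2 ^ n}"

primrec free_count :: "(nat \<Rightarrow> bool) \<Rightarrow> nat \<Rightarrow> nat" where
  "free_count fr 0 = 0"
| "free_count fr (Suc j) = free_count fr j + (if fr j then 1 else 0)"

text \<open>
  The first \<open>j\<close> binary digits of a point, read as an integer: the free digits are copied from the
  binary expansion of \<open>u\<close>, and the others are prescribed by \<open>r\<close> in terms of the digits before them.
\<close>
primrec digit_prefix :: "(nat \<Rightarrow> bool) \<Rightarrow> (nat \<Rightarrow> nat \<Rightarrow> nat) \<Rightarrow> nat \<Rightarrow> real \<Rightarrow> nat" where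
  "digit_prefix fr r 0 u = 0"
| "digit_prefix fr r (Suc j) u = 2 * digit_prefix fr r j u +
     (if fr j then nat \<lfloor>2 ^ Suc (free_count fr j) * u\<rfloor> mod 2 else r j (digit_prefix fr r j u))"

definition digit_point :: "(nat \<Rightarrow> bool) \<Rightarrow> (nat \<Rightarrow> nat \<Rightarrow> nat) \<Rightarrow> real \<Rightarrow> real" where
  "digit_point fr r u = (SUP j. real (digit_prefix fr r j u) / 2 ^ j)"

locale digit_scheme =
  fixes fr :: "nat \<Rightarrow> bool" and r :: "nat \<Rightarrow> nat \<Rightarrow> nat"
  assumes rule_le_1: "r j p \<le> 1"
begin

abbreviation "N \<equiv> free_count fr"
abbreviation "P \<equiv> digit_prefix fr r"
abbreviation "\<phi> \<equiv> digit_point fr r"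

lemma prefix_Suc: "2 * P j u \<le> P (Suc j) u" "P (Suc j) u \<le> 2 * P j u + 1"
  using rule_le_1[of j "P j u"] by auto

lemma prefix_Suc_div_2: "P (Suc j) u div 2 = P j u"
  using prefix_Suc[of j u] by linarith

lemma prefix_add_div: "P (i + m) u div 2 ^ m = P i u"
proof (induction m)
  case (Suc m)
  have "P (i + Suc m) u div 2 ^ Suc m = P (Suc (i + m)) u div 2 div 2 ^ m"
    by (simp only: div_mult2_eq power_Suc add_Suc_right)
  then show ?case
    by (simp only: prefix_Suc_div_2 Suc)
qed simp

lemma prefix_less: "P j u < 2 ^ j"
proof (induction j)
  case (Suc j)
  then show ?case using prefix_Suc(2)[of j u] by (simp del: digit_prefix.simps)
qed simp

text \<open>A further digit never lowers the left endpoint and never raises the right one, so all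
  left endpoints lie below all right endpoints.\<close>

lemma point_in_dyad: "\<phi> u \<in> dyad j (P j u)"
proof -
  have inc: "incseq (\<lambda>j. real (P j u) / 2 ^ j)"
  proof (rule incseq_SucI)
    fix j
    have "2 * real (P j u) \<le> real (P (Suc j) u)"
      using prefix_Suc(1)[of j u] by linarith
    then have "2 * real (P j u) / 2 ^ Suc j \<le> real (P (Suc j) u) / 2 ^ Suc j"
      by (rule divide_right_mono) simp
    then show "real (P j u) / 2 ^ j \<le> real (P (Suc j) u) / 2 ^ Suc j"
      by (simp del: digit_prefix.simps)
  qed
  have dec: "decseq (\<lambda>j. (real (P j u) + 1) / 2 ^ j)"
  proof (rule decseq_SucI)
    fix j
    have "real (P (Suc j) u) \<le> 2 * real (P j u) + 1"
      using prefix_Suc(2)[of j u] by linarith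
    then have "(real (P (Suc j) u) + 1) / 2 ^ Suc j \<le> (2 * (real (P j u) + 1)) / 2 ^ Suc j"
      by (intro divide_right_mono) auto
    then show "(real (P (Suc j) u) + 1) / 2 ^ Suc j \<le> (real (P j u) + 1) / 2 ^ j"
      by (simp only: power_Suc mult_divide_mult_cancel_left zero_neq_numeral[symmetric] not_False_eq_True)
  qed
  have le: "real (P i u) / 2 ^ i \<le> (real (P j u) + 1) / 2 ^ j" for i j
  proof -
    have "real (P i u) / 2 ^ i \<le> real (P (max i j) u) / 2 ^ max i j"
      by (rule incseqD[OF inc]) simp
    also have "\<dots> \<le> (real (P (max i j) u) + 1) / 2 ^ max i j"
      by (simp add: divide_right_mono)
    also have "\<dots> \<le> (real (P j u) + 1) / 2 ^ j"
      by (rule decseqD[OF dec]) simp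
    finally show ?thesis .
  qed
  then have "bdd_above (range (\<lambda>i. real (P i u) / 2 ^ i))"
    by (intro bdd_aboveI[where M = "(real (P j u) + 1) / 2 ^ j"]) auto
  then show ?thesis
    unfolding dyad_def digit_point_def using le by (auto intro!: cSUP_upper cSUP_least)
qed

text \<open>The free digits of a prefix are the leading binary digits of the parameter, and the
  forced digits depend only on earlier ones. This injectivity at scale \<open>1 / 2 ^ N j\<close>
  underlies every measure estimate below.\<close>

lemma prefix_determines_floor:
  assumes "u \<in> {0..<1}" "v \<in> {0..<1}" "P j u = P j v"
  shows "nat \<lfloor>2 ^ N j * u\<rfloor> = nat \<lfloor>2 ^ N j * v\<rfloor>"
  using assms(3)
proof (induction j)
  case 0
  have "\<lfloor>u\<rfloor> = 0" "\<lfloor>v\<rfloor> = 0"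
    using assms by (simp_all add: floor_eq_iff)
  then show ?case by simp
next
  case (Suc j)
  have eq: "P j u = P j v"
    using Suc.prems prefix_Suc_div_2 by metis
  define a b where "a = nat \<lfloor>2 ^ Suc (N j) * u\<rfloor>" and "b = nat \<lfloor>2 ^ Suc (N j) * v\<rfloor>"
  \<comment> \<open>Halving removes the last binary digit and so links the floors at consecutive
    precisions.\<close>
  have half: "nat \<lfloor>2 ^ Suc m * w\<rfloor> div 2 = nat \<lfloor>2 ^ m * w\<rfloor>" for m and w :: real
  proof -
    have "nat \<lfloor>2 ^ Suc m * w\<rfloor> div 2 = nat (\<lfloor>2 ^ Suc m * w\<rfloor> div 2)"
      by (simp only: nat_div_distrib' zero_le_numeral nat_numeral)
    also have "\<lfloor>2 ^ Suc m * w\<rfloor> div 2 = \<lfloor>2 ^ Suc m * w / real_of_int 2\<rfloor>"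
      by (rule floor_divide_real_eq_div[symmetric]) simp
    also have "2 ^ Suc m * w / real_of_int 2 = 2 ^ m * w"
      by simp
    finally show ?thesis .
  qed
  have "a div 2 = b div 2"
    unfolding a_def b_def half by (rule Suc.IH[OF eq])
  show ?case
  proof (cases "fr j")
    case True
    then have "a mod 2 = b mod 2"
      using Suc.prems eq by (simp add: a_def b_def)
    with \<open>a div 2 = b div 2\<close> have "a = b"
      by (metis div_mult_mod_eq)
    moreover have "N (Suc j) = Suc (N j)"
      using True by simp
    ultimately show ?thesis
      by (simp only: a_def b_def)
  next
    case False
    then have "N (Suc j) = N j" by simp
    then show ?thesis
      by (simp only: Suc.IH[OF eq])
  qed
qed

text \<open>All parameters with a given prefix share one dyadic interval of length
  \<open>1 / 2 ^ N j\<close>. A measurable superset replaces the preimage, so measurability of the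
  digit map does not enter.\<close>

lemma prefix_preimage_cover:
  assumes "finite T"
  obtains W where "W \<in> lmeasurable" "{u \<in> {0..<1}. P j u \<in> T} \<subseteq> W"
    "measure lebesgue W \<le> card T / 2 ^ N j"
proof
  \<comment> \<open>Any parameter with prefix \<open>p\<close> gives the same floor. For a prefix
    that is never attained the choice is arbitrary and harmless, as there is nothing to
    cover.\<close>
  define q where "q p = real (nat \<lfloor>2 ^ N j * (SOME u. u \<in> {0..<1} \<and> P j u = p)\<rfloor>)" for p
  let ?I = "\<lambda>p. {q p / 2 ^ N j .. (q p + 1) / 2 ^ N j}"
  let ?W = "\<Union>p\<in>T. ?I p"
  show "?W \<in> lmeasurable"
    using assms by (intro fmeasurable.finite_UN) auto
  have "measure lebesgue ?W \<le> (\<Sum>p\<in>T. measure lebesgue (?I p))"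
    using assms by (intro measure_UNION_le) auto
  also have "\<dots> = (\<Sum>p\<in>T. 1 / 2 ^ N j)"
    by (intro sum.cong) (auto simp: diff_divide_distrib[symmetric] divide_right_mono)
  finally show "measure lebesgue ?W \<le> card T / 2 ^ N j" by simp
  show "{u \<in> {0..<1}. P j u \<in> T} \<subseteq> ?W"
  proof clarify
    fix u :: real assume u: "u \<in> {0..<1}" "P j u \<in> T"
    define v where "v = (SOME v. v \<in> {0..<1} \<and> P j v = P j u)"
    have v: "v \<in> {0..<1} \<and> P j v = P j u"
      unfolding v_def by (rule someI[where x = u]) (use u in simp)
    then have "nat \<lfloor>2 ^ N j * v\<rfloor> = nat \<lfloor>2 ^ N j * u\<rfloor>"
      using u by (intro prefix_determines_floor) auto
    then have "q (P j u) = real (nat \<lfloor>2 ^ N j * u\<rfloor>)"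
      by (simp add: q_def v_def)
    also have "\<dots> = of_int \<lfloor>2 ^ N j * u\<rfloor>"
      using u by simp
    finally have "q (P j u) \<le> 2 ^ N j * u" "2 ^ N j * u \<le> q (P j u) + 1"
      by linarith+
    then have "u \<in> ?I (P j u)"
      by (simp add: field_simps)
    with u show "u \<in> ?W" by blast
  qed
qed

text \<open>Points within distance \<open>1 / 2 ^ j\<close> have prefixes of length \<open>j\<close>
  differing by at most 2, which leaves at most 5 prefixes.\<close>

lemma small_set_preimage_cover:
  assumes "bounded U" "diameter U \<le> 1 / 2 ^ j"
  obtains W where "W \<in> lmeasurable" "{u \<in> {0..<1}. \<phi> u \<in> U} \<subseteq> W"
    "measure lebesgue W \<le> 5 / 2 ^ N j"
proof -
  have "\<exists>T. finite T \<and> card T \<le> 5 \<and> {u \<in> {0..<1}. \<phi> u \<in> U} \<subseteq> {u \<in> {0..<1}. P j u \<in> T}"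
  proof (cases "\<exists>u. \<phi> u \<in> U")
    case True
    then obtain v where v: "\<phi> v \<in> U" by blast
    define T where "T = {P j v - 2 .. P j v + 2}"
    have "P j u \<in> T" if u: "\<phi> u \<in> U" for u
    proof -
      have "\<bar>\<phi> u - \<phi> v\<bar> \<le> 1 / 2 ^ j"
        using diameter_bounded_bound[OF assms(1) u v] assms(2) by (simp add: dist_real_def)
      then have "\<phi> u * 2 ^ j - \<phi> v * 2 ^ j \<le> 1" "\<phi> v * 2 ^ j - \<phi> u * 2 ^ j \<le> 1"
        by (auto simp: abs_le_iff field_simps)
      moreover have "real (P j w) \<le> \<phi> w * 2 ^ j" "\<phi> w * 2 ^ j \<le> real (P j w) + 1" for w
        using point_in_dyad[of w j] by (auto simp: dyad_def field_simps)
      note this[of u] this[of v]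
      ultimately show ?thesis unfolding T_def atLeastAtMost_iff by linarith
    qed
    then show ?thesis by (intro exI[of _ T]) (auto simp: T_def)
  qed (auto intro: exI[of _ "{}"])
  then obtain T where T: "finite T" "card T \<le> 5" "{u \<in> {0..<1}. \<phi> u \<in> U} \<subseteq> {u \<in> {0..<1}. P j u \<in> T}"
    by blast
  from prefix_preimage_cover[OF T(1)] obtain W where W: "W \<in> lmeasurable" "{u \<in> {0..<1}. P j u \<in> T} \<subseteq> W"
    "measure lebesgue W \<le> card T / 2 ^ N j" .
  show thesis
  proof
    show "measure lebesgue W \<le> 5 / 2 ^ N j"
    proof -
      have "real (card T) / 2 ^ N j \<le> 5 / 2 ^ N j"
        using T(2) by (intro divide_right_mono) auto
      with W(3) show ?thesis by linarith
    qed
  qed (use W T in auto)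
qed

text \<open>Mass distribution principle for the image of Lebesgue measure under the digit map. The
  digit count is assumed at every \<open>j\<close> because covering sets may have any scale.\<close>

lemma hausdorff_dim_point_image:
  assumes "0 < s" and count: "\<And>j. s * real j - c \<le> real (N j)" and E: "\<phi> ` {0..<1} \<subseteq> E"
  shows "ereal s \<le> hausdorff_dim E"
proof (rule hausdorff_dim_ge)
  fix s' assume s': "0 \<le> s'" "s' < s"
  \<comment> \<open>The 5 counts prefixes, \<open>2 powr c\<close> is the defect in the digit count,
    and \<open>2 powr s\<close> arises because the diameter is only known to exceed
    \<open>2^-(j+1)\<close> when prefixes of length \<open>j\<close> are used.\<close>
  define C where "C = 5 * 2 powr (c + s)"
  have C: "0 < C" by (simp add: C_def)
  have N_bound: "1 / 2 ^ N j \<le> 2 powr (c - s * real j)" for j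
  proof -
    have "1 / 2 ^ N j = 2 powr (- real (N j))"
      by (simp add: powr_minus_divide powr_realpow)
    also have "\<dots> \<le> 2 powr (c - s * real j)"
      using count[of j] by (intro powr_mono) auto
    finally show ?thesis .
  qed
  have pre: "\<exists>W \<in> lmeasurable. {u \<in> {0..<1}. \<phi> u \<in> U} \<subseteq> W \<and> emeasure lebesgue W \<le> ennreal C * diam_powr s' U"
    if U: "bounded U" "diameter U \<le> 1" for U
  proof (cases "diameter U = 0")
    case True
    have lim: "(\<lambda>j. 5 * 2 powr (c - s * real j)) \<longlonglongrightarrow> 0"
    proof -
      have "2 powr (- s) < 1"
        using \<open>0 < s\<close> powr_less_cancel_iff[of 2 "- s" 0] by simp
      then have "(\<lambda>j. 5 * 2 powr c * (2 powr (- s)) ^ j) \<longlonglongrightarrow> 0"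
        by (intro tendsto_mult_right_zero LIMSEQ_realpow_zero) auto
      also have "(\<lambda>j. 5 * 2 powr c * (2 powr (- s)) ^ j) = (\<lambda>j. 5 * 2 powr (c - s * real j))"
        by (simp add: fun_eq_iff powr_powr powr_add[symmetric] powr_realpow[symmetric])
      finally show ?thesis .
    qed
    \<comment> \<open>For positive \<open>s'\<close> a set of diameter 0 costs nothing, so its
      preimage must be null. It is, since the small-set estimate applies at every order
      \<open>j\<close>.\<close>
    have "negligible {u \<in> {0..<1}. \<phi> u \<in> U}"
      unfolding negligible_outer
    proof (intro allI impI)
      fix e :: real assume "0 < e"
      then obtain j where j: "5 * 2 powr (c - s * real j) < e"
        using order_tendstoD(2)[OF lim] by (auto simp: eventually_sequentially)
      obtain W where "W \<in> lmeasurable" "{u \<in> {0..<1}. \<phi> u \<in> U} \<subseteq> W" "measure lebesgue W \<le> 5 / 2 ^ N j"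
        using small_set_preimage_cover[OF U(1), of j] True by auto
      then show "\<exists>T. {u \<in> {0..<1}. \<phi> u \<in> U} \<subseteq> T \<and> T \<in> lmeasurable \<and> measure lebesgue T < e"
        using j N_bound[of j] by (intro exI[of _ W]) auto
    qed
    then have "{u \<in> {0..<1}. \<phi> u \<in> U} \<in> null_sets lebesgue"
      by (simp add: negligible_iff_null_sets)
    then show ?thesis
      by (intro bexI[of _ "{u \<in> {0..<1}. \<phi> u \<in> U}"]) (auto simp: null_setsD1 intro: fmeasurableI_null_sets)
  next
    case False
    then have D: "0 < diameter U" using diameter_ge_0[OF U(1)] by linarith
    \<comment> \<open>The dyadic scale of \<open>U\<close>: as the diameter is at most 1,
      \<open>n\<close> is positive, and its predecessor \<open>j\<close> satisfies
      \<open>2^-(j+1) < diameter U\<close> and \<open>diameter U \<le> 2^-j\<close>.\<close>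
    define n where "n = (LEAST n. (1 / 2) ^ n < diameter U)"
    have "\<exists>n. (1 / 2 :: real) ^ n < diameter U"
      using real_arch_pow_inv[OF D, of "1 / 2"] by simp
    then have n: "(1 / 2) ^ n < diameter U"
      unfolding n_def by (rule LeastI_ex)
    then obtain j where j: "n = Suc j"
      using U by (cases n) auto
    have "\<not> (1 / 2) ^ j < diameter U"
      using not_less_Least[of j "\<lambda>n. (1 / 2) ^ n < diameter U"] j by (simp add: n_def)
    then have "diameter U \<le> 1 / 2 ^ j"
      by (simp add: power_one_over)
    from small_set_preimage_cover[OF U(1) this] obtain W where
      W: "W \<in> lmeasurable" "{u \<in> {0..<1}. \<phi> u \<in> U} \<subseteq> W" "measure lebesgue W \<le> 5 / 2 ^ N j" .
    have "measure lebesgue W \<le> 5 * 2 powr (c - s * real j)"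
      using W(3) N_bound[of j] by simp
    also have "\<dots> = C * ((1 / 2) ^ n) powr s"
    proof -
      have "(1 / 2 :: real) ^ n = 2 powr (- real n)"
        by (simp add: powr_minus_divide powr_realpow power_one_over)
      then show ?thesis
        by (simp add: C_def j powr_powr powr_add[symmetric] algebra_simps)
    qed
    also have "\<dots> \<le> C * diameter U powr s"
      using n C \<open>0 < s\<close> by (intro mult_left_mono powr_mono2) auto
    finally have "emeasure lebesgue W \<le> ennreal (C * diameter U powr s)"
      using W(1) by (simp add: emeasure_eq_measure2 ennreal_leI)
    also have "\<dots> = ennreal C * diam_powr s U"
      using C \<open>0 < s\<close> D by (auto simp: diam_powr_def ennreal_mult)
    also have "\<dots> \<le> ennreal C * diam_powr s' U"
      using s' \<open>0 < s\<close> U by (intro mult_left_mono diam_powr_mono_exponent) auto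
    finally show ?thesis using W by blast
  qed
  have "ennreal (1 / C) \<le> hausdorff_content s' 1 E"
    unfolding hausdorff_content_def
  proof (rule INF_greatest, clarify)
    fix U :: "nat \<Rightarrow> real set"
    assume cov: "E \<subseteq> (\<Union>i. U i)" and U: "\<forall>i. bounded (U i) \<and> diameter (U i) \<le> 1"
    have "\<forall>i. \<exists>W \<in> lmeasurable. {u \<in> {0..<1}. \<phi> u \<in> U i} \<subseteq> W \<and> emeasure lebesgue W \<le> ennreal C * diam_powr s' (U i)"
      using pre U by blast
    then obtain W where W: "\<And>i. W i \<in> lmeasurable" "\<And>i. {u \<in> {0..<1}. \<phi> u \<in> U i} \<subseteq> W i"
      "\<And>i. emeasure lebesgue (W i) \<le> ennreal C * diam_powr s' (U i)"
      by metis
    have "1 = emeasure lebesgue {0..<1::real}" by simp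
    also have "\<dots> \<le> emeasure lebesgue (\<Union>i. W i)"
    proof (rule emeasure_mono)
      show "{0..<1} \<subseteq> (\<Union>i. W i)"
      proof
        fix u :: real assume u: "u \<in> {0..<1}"
        then obtain i where "\<phi> u \<in> U i" using E cov by blast
        then show "u \<in> (\<Union>i. W i)" using u W(2)[of i] by blast
      qed
    qed (use W in auto)
    also have "\<dots> \<le> (\<Sum>i. emeasure lebesgue (W i))"
      using W by (intro emeasure_subadditive_countably) auto
    also have "\<dots> \<le> (\<Sum>i. ennreal C * diam_powr s' (U i))"
      by (intro suminf_le W) auto
    also have "\<dots> = ennreal C * (\<Sum>i. diam_powr s' (U i))"
      by simp
    finally have "ennreal (1 / C) * 1 \<le> ennreal (1 / C) * (ennreal C * (\<Sum>i. diam_powr s' (U i)))"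
      by (intro mult_left_mono) auto
    also have "\<dots> = (\<Sum>i. diam_powr s' (U i))"
      using C by (simp add: mult.assoc[symmetric] ennreal_mult'[symmetric])
    finally show "ennreal (1 / C) \<le> (\<Sum>i. diam_powr s' (U i))" by simp
  qed
  also have "\<dots> \<le> hausdorff_measure s' E"
    unfolding hausdorff_measure_def by (rule SUP_upper) simp
  finally show "hausdorff_measure s' E \<noteq> 0"
    using C by auto
qed

end

section \<open>Lower bounds for packing measure\<close>

text \<open>Adjacent closed intervals share an endpoint; equal parity skips at least one interval
  and so forces a gap of a full length.\<close>

lemma dyad_separation:
  assumes "x \<in> dyad j p" "y \<in> dyad j q" "p mod 2 = q mod 2" "p < q"
  shows "1 / 2 ^ j \<le> y - x"
proof -
  have "p + 2 \<le> q" using assms(3,4) by presburger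
  then have "real p + 2 \<le> real q" by linarith
  then have "(real p + 1) / 2 ^ j + 1 / 2 ^ j \<le> real q / 2 ^ j"
    unfolding add_divide_distrib[symmetric] by (intro divide_right_mono) auto
  then show ?thesis using assms(1,2) by (auto simp: dyad_def)
qed

text \<open>Indices of one parity give points at distance at least \<open>1 / 2 ^ j\<close>, hence a
  packing. Its content being below 1 bounds their number, and the two parities are added.\<close>

lemma card_le_of_packing_content:
  fixes X :: "real set"
  assumes content: "packing_content s d X < 1" and j: "1 / 2 ^ j \<le> d" and s: "s \<le> 1"
    and T: "finite T" "\<And>p. p \<in> T \<Longrightarrow> X \<inter> dyad j p \<noteq> {}"
  shows "real (card T) \<le> 4 * 2 powr (s * real j)"
proof -
  obtain g where g: "\<And>p. p \<in> T \<Longrightarrow> g p \<in> X \<inter> dyad j p"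
    using bchoice[of T "\<lambda>p x. x \<in> X \<inter> dyad j p"] T(2) by blast
  \<comment> \<open>A third rather than a half, because closed balls of half the distance could
    touch.\<close>
  define \<rho> :: real where "\<rho> = 1 / (3 * 2 ^ j)"
  have \<rho>: "0 < \<rho>" "\<rho> \<le> d" "2 * \<rho> < 1 / 2 ^ j"
    using j by (auto simp: \<rho>_def field_simps)
  have half: "real (card {p \<in> T. p mod 2 = b}) \<le> 2 * 2 powr (s * real j)" for b
  proof -
    define S where "S = {p \<in> T. p mod 2 = b}"
    have S: "finite S" "S \<subseteq> T" using T(1) by (auto simp: S_def)
    have less_far: "2 * \<rho> < dist (g p) (g q)" if "p \<in> S" "q \<in> S" "p < q" for p q
    proof -
      have "1 / 2 ^ j \<le> g q - g p"
        using that g S(2) by (intro dyad_separation[of _ _ p _ q]) (auto simp: S_def)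
      then show ?thesis using \<rho>(3) by (simp add: dist_real_def)
    qed
    have far: "2 * \<rho> < dist (g p) (g q)" if "p \<in> S" "q \<in> S" "p \<noteq> q" for p q
      using less_far[of p q] less_far[of q p] that by (auto simp: dist_commute neq_iff)
    let ?B = "(\<lambda>p. (g p, \<rho>)) ` S"
    have inj: "inj_on (\<lambda>p. (g p, \<rho>)) S"
      using far \<rho>(1) by (intro inj_onI) (metis Pair_inject dist_self mult_pos_pos not_less_iff_gr_or_eq zero_less_numeral)
    have "?B \<in> packings d X"
    proof -
      have "disjoint_family_on (\<lambda>(x, r). cball x r) ?B"
        unfolding disjoint_family_on_def
      proof (intro ballI impI)
        fix v w assume "v \<in> ?B" "w \<in> ?B" "v \<noteq> w"
        then obtain p q where pq: "p \<in> S" "q \<in> S" "p \<noteq> q" "v = (g p, \<rho>)" "w = (g q, \<rho>)"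
          by auto
        have "cball (g p) \<rho> \<inter> cball (g q) \<rho> = {}"
          using far[OF pq(1-3)] by (intro disjoint_cballI) simp
        then show "(case v of (x, r) \<Rightarrow> cball x r) \<inter> (case w of (x, r) \<Rightarrow> cball x r) = {}"
          by (simp add: pq)
      qed
      then show ?thesis
        unfolding packings_def using S g \<rho> by (auto intro: countable_finite)
    qed
    then have "(\<Sum>\<^sub>\<infinity>(x, r)\<in>?B. ennreal ((2 * r) powr s)) \<le> packing_content s d X"
      unfolding packing_content_def by (rule SUP_upper)
    also have "(\<Sum>\<^sub>\<infinity>(x, r)\<in>?B. ennreal ((2 * r) powr s)) = (\<Sum>(x, r)\<in>?B. ennreal ((2 * r) powr s))"
      using S by (intro infsum_finite) simp
    also have "\<dots> = (\<Sum>p\<in>S. ennreal ((2 * \<rho>) powr s))"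
      by (simp only: sum.reindex[OF inj] o_def case_prod_conv)
    also have "\<dots> = ennreal (real (card S) * (2 * \<rho>) powr s)"
      by (simp add: ennreal_mult ennreal_of_nat_eq_real_of_nat)
    finally have less: "real (card S) * (2 * \<rho>) powr s < 1"
      using content ennreal_less_one_iff by (meson order_le_less_trans)
    \<comment> \<open>Here \<open>s \<le> 1\<close> enters: it bounds \<open>(2 / 3) powr s\<close>
      below by 1/2, the source of the factor 2 for each parity.\<close>
    have "(1 / 2) * 2 powr (- (s * real j)) \<le> (2 / 3) powr s * 2 powr (- (s * real j))"
    proof (intro mult_right_mono)
      have "(2 / 3 :: real) powr 1 \<le> (2 / 3) powr s"
        using s by (intro powr_mono') auto
      then show "(1 / 2 :: real) \<le> (2 / 3) powr s" by simp
    qed simp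
    also have "\<dots> = (2 * \<rho>) powr s"
    proof -
      have "2 * \<rho> = (2 / 3) * 2 powr (- real j)"
        by (simp add: \<rho>_def powr_minus_divide powr_realpow)
      then show ?thesis
        by (simp only: powr_mult powr_powr) (simp add: mult.commute)
    qed
    finally have "real (card S) * ((1 / 2) * 2 powr (- (s * real j))) \<le> real (card S) * (2 * \<rho>) powr s"
      by (intro mult_left_mono) auto
    with less have "real (card S) * ((1 / 2) * 2 powr (- (s * real j))) \<le> 1"
      by linarith
    then show ?thesis
      by (simp add: S_def powr_minus_divide field_simps)
  qed
  have "T = {p \<in> T. p mod 2 = 0} \<union> {p \<in> T. p mod 2 = 1}" by auto
  then have "card T \<le> card {p \<in> T. p mod 2 = 0} + card {p \<in> T. p mod 2 = 1}"
    by (metis card_Un_le)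
  then show ?thesis using half[of 0] half[of 1] by linarith
qed

context digit_scheme begin

text \<open>Image points in \<open>X\<close> have at most \<open>4 * 2 powr (s * real j)\<close>
  prefixes of length \<open>j\<close>, each pulling back to measure at most
  \<open>1 / 2 ^ N j\<close>. The packing scale \<open>d\<close> is fixed first, so
  \<open>growth\<close> must supply orders beyond any \<open>J\<close>.\<close>

lemma negligible_preimage_of_packing_premeasure:
  assumes pre: "packing_premeasure s X < 1" and s: "s \<le> 1"
    and growth: "\<And>e J. 0 < e \<Longrightarrow> \<exists>j\<ge>J. 2 powr (s * real j - real (N j)) < e"
  shows "negligible {u \<in> {0..<1}. \<phi> u \<in> X}"
  unfolding negligible_outer
proof (intro allI impI)
  fix e :: real assume "0 < e"
  from pre obtain d where d: "0 < d" "packing_content s d X < 1"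
    unfolding packing_premeasure_def INF_less_iff by auto
  obtain J where J: "(1 / 2) ^ J < d"
    using real_arch_pow_inv[OF d(1), of "1 / 2"] by auto
  obtain j where j: "J \<le> j" "2 powr (s * real j - real (N j)) < e / 4"
    using growth[of "e / 4" J] \<open>0 < e\<close> by auto
  have "1 / 2 ^ j \<le> d"
    using power_decreasing[OF j(1), of "1 / 2 :: real"] J by (simp add: power_one_over)
  define T where "T = P j ` {u \<in> {0..<1}. \<phi> u \<in> X}"
  have "finite T"
    by (rule finite_subset[of _ "{..<2 ^ j}"]) (auto simp: T_def prefix_less)
  moreover have "X \<inter> dyad j p \<noteq> {}" if "p \<in> T" for p
    using that point_in_dyad by (auto simp: T_def)
  ultimately have card: "real (card T) \<le> 4 * 2 powr (s * real j)"
    using d(2) \<open>1 / 2 ^ j \<le> d\<close> s by (intro card_le_of_packing_content)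
  from prefix_preimage_cover[OF \<open>finite T\<close>] obtain W where
    W: "W \<in> lmeasurable" "{u \<in> {0..<1}. P j u \<in> T} \<subseteq> W" "measure lebesgue W \<le> card T / 2 ^ N j" .
  note W(3)
  also have "real (card T) / 2 ^ N j \<le> 4 * 2 powr (s * real j) / 2 ^ N j"
    using card by (intro divide_right_mono) auto
  also have "\<dots> = 4 * 2 powr (s * real j - real (N j))"
    by (simp add: powr_diff powr_realpow)
  also have "\<dots> < e" using j(2) by simp
  finally show "\<exists>T. {u \<in> {0..<1}. \<phi> u \<in> X} \<subseteq> T \<and> T \<in> lmeasurable \<and> measure lebesgue T < e"
    using W by (intro exI[of _ W]) (auto simp: T_def)
qed

text \<open>If the packing measure vanished, countably many sets of premeasure below 1 would cover
  the image, and their null preimages would exhaust the unit interval. Unlike in the Hausdorff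
  bound, favourable orders \<open>j\<close> only have to occur arbitrarily late.\<close>

lemma packing_measure_point_image:
  assumes s: "s \<le> 1"
    and growth: "\<And>e J. 0 < e \<Longrightarrow> \<exists>j\<ge>J. 2 powr (s * real j - real (N j)) < e"
    and E: "\<phi> ` {0..<1} \<subseteq> E"
  shows "packing_measure s E \<noteq> 0"
proof
  assume "packing_measure s E = 0"
  then have "packing_measure s E < 1" by simp
  then obtain F :: "nat \<Rightarrow> real set" where F: "E \<subseteq> (\<Union>i. F i)" "(\<Sum>i. packing_premeasure s (F i)) < 1"
    unfolding packing_measure_def INF_less_iff by auto
  have "packing_premeasure s (F i) < 1" for i
    using F(2) sum_le_suminf[of "\<lambda>i. packing_premeasure s (F i)" "{i}"] by (auto intro: order_le_less_trans)
  then have "negligible {u \<in> {0..<1}. \<phi> u \<in> F i}" for i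
    by (rule negligible_preimage_of_packing_premeasure[OF _ s growth])
  then have "negligible (\<Union>i. {u \<in> {0..<1}. \<phi> u \<in> F i})"
    by (intro negligible_countable_Union) auto
  \<comment> \<open>The parameters fill only \<open>{0..<1}\<close>; adding the point 1 reaches the
    closed interval.\<close>
  then have "negligible (insert 1 (\<Union>i. {u \<in> {0..<1}. \<phi> u \<in> F i}))"
    by simp
  moreover have "cbox 0 (1 :: real) \<subseteq> insert 1 (\<Union>i. {u \<in> {0..<1}. \<phi> u \<in> F i})"
    using E F(1) by force
  ultimately have "negligible (cbox 0 (1 :: real))"
    by (rule negligible_subset)
  then show False
    by (subst (asm) negligible_interval) (simp add: box_real)
qed

end

section \<open>Closed sets with restricted binary digits\<close>

primrec digit_tree :: "(nat \<Rightarrow> bool) \<Rightarrow> nat \<Rightarrow> nat set" where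
  "digit_tree g 0 = {0}"
| "digit_tree g (Suc j) = (\<lambda>p. 2 * p) ` digit_tree g j \<union>
     (if g j then (\<lambda>p. 2 * p + 1) ` digit_tree g j else {})"

text \<open>Finite unions of closed intervals at every order make closedness immediate, and the size
  of \<open>digit_tree\<close> bounds the covering numbers.\<close>

definition digit_set :: "(nat \<Rightarrow> bool) \<Rightarrow> real set" where
  "digit_set g = (\<Inter>j. \<Union>p\<in>digit_tree g j. dyad j p)"

lemma finite_digit_tree [simp]: "finite (digit_tree g j)"
  by (induction j) auto

lemma card_digit_tree: "card (digit_tree g j) \<le> 2 ^ free_count g j"
proof (induction j)
  case (Suc j)
  have "card (digit_tree g (Suc j)) \<le> card ((\<lambda>p. 2 * p) ` digit_tree g j) +
      card (if g j then (\<lambda>p. 2 * p + 1) ` digit_tree g j else {})"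
    unfolding digit_tree.simps by (rule card_Un_le)
  also have "\<dots> \<le> card (digit_tree g j) + (if g j then card (digit_tree g j) else 0)"
    by (intro add_mono) (auto intro: card_image_le)
  finally show ?case using Suc by auto
qed simp

lemma closed_digit_set: "closed (digit_set g)"
  unfolding digit_set_def dyad_def by (intro closed_INT ballI closed_UN) auto

lemma digit_set_subset: "digit_set g \<subseteq> {0..1}"
proof
  fix x assume "x \<in> digit_set g"
  then have "x \<in> (\<Union>p\<in>digit_tree g 0. dyad 0 p)"
    unfolding digit_set_def by blast
  then show "x \<in> {0..1}" by (simp add: dyad_def)
qed

lemma (in digit_scheme) point_in_digit_set:
  assumes "\<And>j. \<not> g j \<Longrightarrow> \<not> fr j \<and> (\<forall>p. r j p = 0)"
  shows "\<phi> u \<in> digit_set g"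
proof -
  have "P j u \<in> digit_tree g j" for j
  proof (induction j)
    case (Suc j)
    have "P (Suc j) u = 2 * P j u \<or> P (Suc j) u = 2 * P j u + 1"
      using prefix_Suc[of j u] by linarith
    moreover have "P (Suc j) u = 2 * P j u" if "\<not> g j"
      using assms[OF that] by simp
    ultimately show ?case using Suc by (auto simp del: digit_prefix.simps)
  qed simp
  then show ?thesis unfolding digit_set_def using point_in_dyad by blast
qed

section \<open>The sparse digit set and steering\<close>

lemma free_count_le: "free_count fr j \<le> j"
  by (induction j) auto

lemma free_count_mono: "i \<le> j \<Longrightarrow> free_count fr i \<le> free_count fr j"
  by (induction j rule: dec_induct) auto

lemma free_count_run:
  assumes "a \<le> b" "\<And>i. a \<le> i \<Longrightarrow> i < b \<Longrightarrow> fr i"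
  shows "free_count fr b = free_count fr a + (b - a)"
  using assms by (induction b rule: dec_induct) auto

text \<open>For \<open>0 \<le> t \<le> 1\<close> the floor jumps by at most one, so exactly
  \<lfloor>t n\<rfloor> positions below n qualify: density \<open>t\<close> with error below 1 at
  every length.\<close>

definition beatty :: "real \<Rightarrow> nat \<Rightarrow> bool" where
  "beatty t i \<longleftrightarrow> \<lfloor>t * real i\<rfloor> < \<lfloor>t * real (Suc i)\<rfloor>"

text \<open>As \<open>t \<le> 1\<close>, a jump of the floor is at most 1 and is paid for by one
  free digit; the sum telescopes.\<close>

lemma free_count_ge_beatty:
  assumes "t \<le> 1" "a \<le> b" "\<And>i. a \<le> i \<Longrightarrow> i < b \<Longrightarrow> beatty t i \<Longrightarrow> fr i"
  shows "int (free_count fr a) + \<lfloor>t * real b\<rfloor> - \<lfloor>t * real a\<rfloor> \<le> int (free_count fr b)"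
  using assms(2,3)
proof (induction b rule: dec_induct)
  case (step i)
  have "t * real (Suc i) \<le> t * real i + 1"
    using assms(1) by (simp add: algebra_simps)
  then have "\<lfloor>t * real (Suc i)\<rfloor> \<le> \<lfloor>t * real i\<rfloor> + 1"
    by linarith
  then have "\<lfloor>t * real (Suc i)\<rfloor> \<le> \<lfloor>t * real i\<rfloor> + (if fr i then 1 else 0)"
    using step.prems[of i] step.hyps unfolding beatty_def by fastforce
  then show ?case using step by (auto simp del: of_nat_Suc)
qed simp

lemma free_count_le_beatty:
  assumes "0 \<le> t" "a \<le> b" "\<And>i. a \<le> i \<Longrightarrow> i < b \<Longrightarrow> fr i \<Longrightarrow> beatty t i"
  shows "int (free_count fr b) \<le> int (free_count fr a) + \<lfloor>t * real b\<rfloor> - \<lfloor>t * real a\<rfloor>"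
  using assms(2,3)
proof (induction b rule: dec_induct)
  case (step i)
  have "\<lfloor>t * real i\<rfloor> \<le> \<lfloor>t * real (Suc i)\<rfloor>"
    using assms(1) by (intro floor_mono mult_left_mono) auto
  then have "\<lfloor>t * real i\<rfloor> + (if fr i then 1 else 0) \<le> \<lfloor>t * real (Suc i)\<rfloor>"
    using step.prems[of i] step.hyps unfolding beatty_def by fastforce
  then show ?case using step by (auto simp del: of_nat_Suc)
qed simp

text \<open>The index of the interval \<open>[k!, (k + 1)!)\<close> containing \<open>i\<close>.\<close>
definition block :: "nat \<Rightarrow> nat" where
  "block i = (LEAST k. i < fact (Suc k))"

lemma less_fact_Suc_block: "i < fact (Suc (block i))"
  unfolding block_def
proof (rule LeastI)
  show "i < fact (Suc i)" using fact_ge_self[of "Suc i"] by linarith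
qed

lemma block_eq:
  assumes "fact k \<le> i" "i < fact (Suc k)"
  shows "block i = k"
  unfolding block_def
proof (rule Least_equality)
  fix l assume l: "i < fact (Suc l)"
  show "k \<le> l"
  proof (rule ccontr)
    assume "\<not> k \<le> l"
    then have "(fact (Suc l) :: nat) \<le> fact k" by (intro fact_mono) simp
    then show False using l assms(1) by linarith
  qed
qed (rule assms)

text \<open>Position 0 has block 0 but lies below 0! = 1, so the bound starts at position 1.\<close>

lemma fact_block_le:
  assumes "1 \<le> i"
  shows "fact (block i) \<le> i"
proof (cases "block i")
  case (Suc l)
  then have "\<not> i < fact (Suc l)"
    using not_less_Least[of l "\<lambda>k. i < fact (Suc k)"] by (simp add: block_def)
  then show ?thesis using Suc by (simp add: not_less)
qed (use assms in simp)

text \<open>Each factorial block dominates all earlier ones. The proportion of free digits is thus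
  near 1 at the ends of even blocks, which drives the packing dimension, and near \<open>t\<close>
  at the ends of odd blocks, which caps the Hausdorff dimension.\<close>

definition sparse_free :: "real \<Rightarrow> nat \<Rightarrow> bool" where
  "sparse_free t i \<longleftrightarrow> even (block i) \<or> beatty t i"

lemma free_count_sparse_ge:
  assumes "even k"
  shows "fact (Suc k) - fact k \<le> free_count (sparse_free t) (fact (Suc k))"
proof -
  have "free_count (sparse_free t) (fact (Suc k)) = free_count (sparse_free t) (fact k) + (fact (Suc k) - fact k)"
    using assms by (intro free_count_run fact_mono) (auto simp: sparse_free_def block_eq simp del: fact_Suc)
  then show ?thesis by linarith
qed

lemma free_count_sparse_le:
  assumes "odd k" "0 \<le> t"
  shows "real (free_count (sparse_free t) (fact (Suc k))) \<le> fact k + t * fact (Suc k)"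
proof -
  have "int (free_count (sparse_free t) (fact (Suc k))) \<le> int (free_count (sparse_free t) (fact k)) +
      \<lfloor>t * real (fact (Suc k))\<rfloor> - \<lfloor>t * real (fact k)\<rfloor>"
    using assms by (intro free_count_le_beatty fact_mono) (auto simp: sparse_free_def block_eq simp del: fact_Suc)
  moreover have "free_count (sparse_free t) (fact k) \<le> fact k"
    by (rule free_count_le)
  moreover have "0 \<le> \<lfloor>t * real (fact k)\<rfloor>"
    using assms by simp
  ultimately have "int (free_count (sparse_free t) (fact (Suc k))) \<le> int (fact k) + \<lfloor>t * real (fact (Suc k))\<rfloor>"
    by linarith
  then have "real (free_count (sparse_free t) (fact (Suc k))) \<le> real (fact k) + t * real (fact (Suc k))"
    by linarith
  then show ?thesis by (simp del: fact_Suc)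
qed

section \<open>Steering points into prescribed subintervals\<close>

definition steer_start :: "real \<Rightarrow> nat \<Rightarrow> nat" where
  "steer_start c n = nat \<lceil>c * real n\<rceil>"

lemma steer_start_le: "c \<le> 1 \<Longrightarrow> steer_start c n \<le> n"
  using mult_right_mono[of c 1 "real n"] by (simp add: steer_start_def ceiling_le_iff)

lemma steer_start_ge: "c * real n \<le> real (steer_start c n)"
  unfolding steer_start_def by linarith

lemma steer_start_less: "0 \<le> c \<Longrightarrow> real (steer_start c n) < c * real n + 1"
  unfolding steer_start_def by (simp add: ceiling_correct) linarith

text \<open>
  In an even block ending at \<open>n\<close>, the digits from position \<open>steer_start c n\<close> on are not free: they are used
  to steer the point into a selected interval of order \<open>n\<close>.
\<close>
definition steered :: "real \<Rightarrow> nat \<Rightarrow> bool" where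
  "steered c i \<longleftrightarrow> even (block i) \<and> steer_start c (fact (Suc (block i))) \<le> i"

text \<open>Here \<open>h n x\<close> is the relative index of the target inside the
  \<open>x\<close>-th interval of order \<open>steer_start c n\<close>. The inner division recovers
  \<open>x\<close> from the current prefix; the outer one, with \<open>mod 2\<close>, reads off the
  target digit at position \<open>i\<close>.\<close>

definition steer_rule :: "real \<Rightarrow> (nat \<Rightarrow> nat \<Rightarrow> nat) \<Rightarrow> nat \<Rightarrow> nat \<Rightarrow> nat" where
  "steer_rule c h i p =
     (if steered c i then
        let n = fact (Suc (block i))
        in h n (p div 2 ^ (i - steer_start c n)) div 2 ^ (n - Suc i) mod 2
      else 0)"

definition steer_free :: "real \<Rightarrow> real \<Rightarrow> nat \<Rightarrow> bool" where
  "steer_free c t i \<longleftrightarrow> sparse_free t i \<and> \<not> steered c i"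

text \<open>The deficit does not accumulate: in an even block the digits before steering alone, at
  least \<open>c * n - fact k\<close> of them up to \<open>n = fact (Suc k)\<close>, already support
  slope \<open>s\<close> to the end of the block, and odd blocks proceed with slope
  \<open>t\<close>.\<close>

lemma free_count_steer_ge:
  assumes "0 < s" "s < t" "s < c" "c \<le> 1" "t \<le> 1"
  shows "\<exists>C. \<forall>j. s * real j - C \<le> real (free_count (steer_free c t) j)"
proof -
  let ?N = "free_count (steer_free c t)"
  \<comment> \<open>The slack \<open>\<sigma> - s\<close> pays for the digits before a block: once
    \<open>k\<close> reaches \<open>K0\<close>, \<open>fact k\<close> is at most
    \<open>(\<sigma> - s) * c * fact (Suc k)\<close>.\<close>
  define \<sigma> where "\<sigma> = min t c"
  have \<sigma>: "s < \<sigma>" "\<sigma> \<le> t" "\<sigma> \<le> c" "0 < (\<sigma> - s) * c" "\<sigma> \<le> 1" using assms by (auto simp: \<sigma>_def)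
  obtain K0 :: nat where K0: "1 / ((\<sigma> - s) * c) \<le> real K0"
    using real_arch_simple by blast
  define K where "K = 2 * K0"
  have small: "real (fact k) \<le> (\<sigma> - s) * real j"
    if "K \<le> k" "steer_start c (fact (Suc k)) \<le> j" for k j
  proof -
    have "real K0 \<le> real (Suc k)" using that(1) by (simp add: K_def)
    then have "1 / ((\<sigma> - s) * c) \<le> real (Suc k)" using K0 by linarith
    then have "1 \<le> (\<sigma> - s) * c * real (Suc k)"
      using \<sigma>(4) by (simp add: pos_divide_le_eq mult.commute)
    then have "1 * real (fact k) \<le> (\<sigma> - s) * c * real (Suc k) * real (fact k)"
      by (intro mult_right_mono) auto
    also have "\<dots> = (\<sigma> - s) * (c * real (fact (Suc k)))"
      by (simp add: algebra_simps)
    also have "\<dots> \<le> (\<sigma> - s) * real j"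
      using steer_start_ge[of c "fact (Suc k)"] that(2) \<sigma>(1) by (intro mult_left_mono) (auto simp del: fact_Suc)
    finally show ?thesis by simp
  qed
  have before: "?N j = ?N (fact k) + (j - fact k)"
    if "even k" "fact k \<le> j" "j \<le> fact (Suc k)" "j \<le> steer_start c (fact (Suc k))" for k j
  proof (rule free_count_run)
    fix i assume i: "fact k \<le> i" "i < j"
    then have "block i = k" using that by (intro block_eq) auto
    then show "steer_free c t i"
      using that i by (auto simp: steer_free_def sparse_free_def steered_def simp del: fact_Suc)
  qed (use that in auto)
  have after: "s * real j \<le> real (?N j)"
    if k: "even k" "K \<le> k" and j: "fact k \<le> j" "j \<le> fact (Suc k)" "steer_start c (fact (Suc k)) \<le> j" for k j
  proof -
    let ?a = "steer_start c (fact (Suc k))"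
    \<comment> \<open>Only digits between the start of the block and the start of steering are
      counted; if steering would start before the block, the left side is not positive.\<close>
    have "real ?a - real (fact k) \<le> real (?N j)"
    proof (cases "fact k \<le> ?a")
      case True
      have "?N ?a = ?N (fact k) + (?a - fact k)"
        using k j True by (intro before) auto
      moreover have "?N ?a \<le> ?N j" using j(3) by (rule free_count_mono)
      ultimately show ?thesis by linarith
    next
      case False
      then have "real ?a \<le> real (fact k)" by (intro of_nat_mono) linarith
      then show ?thesis by linarith
    qed
    moreover have "\<sigma> * real j \<le> real ?a"
    proof -
      have "\<sigma> * real j \<le> c * real (fact (Suc k))"
        using of_nat_mono[OF j(2), where 'a = real] \<sigma> assms by (intro mult_mono) auto
      then show ?thesis using steer_start_ge[of c "fact (Suc k)"] by linarith
    qed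
    moreover have "real (fact k) \<le> (\<sigma> - s) * real j"
      using k j by (intro small)
    ultimately show ?thesis by (simp add: algebra_simps del: fact_Suc)
  qed
  have end_even: "s * real (fact (Suc k)) \<le> real (?N (fact (Suc k)))" if "even k" "K \<le> k" for k
    using that by (intro after[of k] steer_start_le fact_mono assms) auto
  \<comment> \<open>The preceding even block ends without deficit; afterwards slope \<open>t\<close>
    exceeds \<open>s\<close>, and rounding costs at most 1.\<close>
  have odd: "s * real j - 1 \<le> real (?N j)"
    if k: "odd k" "K < k" and j: "fact k \<le> j" "j \<le> fact (Suc k)" for k j
  proof -
    obtain l where l: "k = Suc l" using k by (cases k) auto
    have start: "s * real (fact k) \<le> real (?N (fact k))"
      unfolding l by (rule end_even) (use l k in auto)
    have "int (?N (fact k)) + \<lfloor>t * real j\<rfloor> - \<lfloor>t * real (fact k)\<rfloor> \<le> int (?N j)"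
    proof (rule free_count_ge_beatty)
      fix i assume "fact k \<le> i" "i < j" "beatty t i"
      moreover from this have "block i = k" using j by (intro block_eq) auto
      ultimately show "steer_free c t i"
        using k by (simp add: steer_free_def sparse_free_def steered_def)
    qed (use assms j in auto)
    then have "real (?N (fact k)) + t * real j - t * real (fact k) - 1 \<le> real (?N j)"
      by linarith
    moreover have "s * (real j - real (fact k)) \<le> t * (real j - real (fact k))"
      using of_nat_mono[OF j(1), where 'a = real] assms by (intro mult_right_mono) auto
    ultimately show ?thesis using start by (simp add: algebra_simps)
  qed
  \<comment> \<open>Before steering all digits are free, so the deficit left by the odd block cannot
    grow; from then on \<open>after\<close> applies without any inherited bound.\<close>
  have even: "s * real j - 1 \<le> real (?N j)"
    if k: "even k" "K + 2 \<le> k" and j: "fact k \<le> j" "j \<le> fact (Suc k)" for k j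
  proof (cases "steer_start c (fact (Suc k)) \<le> j")
    case True
    then show ?thesis using after[OF k(1) _ j True] k(2) by linarith
  next
    case False
    obtain l where l: "k = Suc l" using k by (cases k) auto
    have start: "s * real (fact k) - 1 \<le> real (?N (fact k))"
      unfolding l by (rule odd[of l]) (use l k in \<open>auto intro: fact_mono simp del: fact_Suc\<close>)
    have "?N j = ?N (fact k) + (j - fact k)"
      using False j k by (intro before) auto
    then have "real (?N j) = real (?N (fact k)) + (real j - real (fact k))"
      using j by simp
    moreover have "s * (real j - real (fact k)) \<le> 1 * (real j - real (fact k))"
      using of_nat_mono[OF j(1), where 'a = real] assms by (intro mult_right_mono) auto
    ultimately show ?thesis using start by (simp add: algebra_simps)
  qed
  show ?thesis
  proof (intro exI allI)
    fix j
    \<comment> \<open>The factorial absorbs the initial blocks up to \<open>K + 1\<close>; the added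
      1 is the rounding deficit.\<close>
    show "s * real j - (fact (Suc (K + 1)) + 1) \<le> real (?N j)"
    proof (cases "j < fact (Suc (K + 1))")
      case True
      have "s * real j \<le> 1 * real j" using assms by (intro mult_right_mono) auto
      moreover have "real j \<le> fact (Suc (K + 1))"
        using True by (metis less_imp_le of_nat_fact of_nat_mono)
      ultimately show ?thesis by linarith
    next
      case False
      have "1 \<le> j" using False fact_ge_1[of "Suc (K + 1)", where 'a = nat] by linarith
      define k where "k = block j"
      have k: "fact k \<le> j" "j \<le> fact (Suc k)"
        using fact_block_le[OF \<open>1 \<le> j\<close>] less_fact_Suc_block[of j] by (auto simp: k_def)
      have "K + 2 \<le> k"
      proof (rule ccontr)
        assume "\<not> K + 2 \<le> k"
        then have "(fact (Suc k) :: nat) \<le> fact (Suc (K + 1))" by (intro fact_mono) simp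
        then show False using False less_fact_Suc_block[of j] unfolding k_def by linarith
      qed
      then have "s * real j - 1 \<le> real (?N j)"
        using even[of k j] odd[of k j] k by (cases "even k") auto
      moreover have "(0::real) \<le> fact (Suc (K + 1))" by simp
      ultimately show ?thesis by linarith
    qed
  qed
qed

lemma digit_scheme_steer: "digit_scheme (steer_rule c h)"
  by standard (auto simp: steer_rule_def Let_def)

text \<open>The steered positions spell out the target index, leading digit first. Steering must
  start inside block \<open>k\<close> so that all positions up to \<open>n\<close> aim at the same
  target.\<close>

lemma steered_prefix:
  fixes t :: real
  assumes "even k" "fact k \<le> steer_start c (fact (Suc k))" "c \<le> 1"
    and h: "\<And>n x. h n x < 2 ^ (n - steer_start c n)"
  defines "n \<equiv> fact (Suc k)" and "P \<equiv> digit_prefix (steer_free c t) (steer_rule c h)"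
  shows "P n u div 2 ^ (n - steer_start c n) = P (steer_start c n) u"
    and "P n u mod 2 ^ (n - steer_start c n) = h n (P n u div 2 ^ (n - steer_start c n))"
proof -
  define a where "a = steer_start c n"
  define y where "y = h n (P a u)"
  have "a \<le> n" unfolding a_def by (rule steer_start_le) fact
  have div: "P i u div 2 ^ (i - a) = P a u" if "a \<le> i" for i
    using digit_scheme.prefix_add_div[OF digit_scheme_steer, of "steer_free c t" c h a "i - a" u] that by (simp add: P_def)
  then show first: "P n u div 2 ^ (n - steer_start c n) = P (steer_start c n) u"
    using \<open>a \<le> n\<close> by (simp add: a_def)
  \<comment> \<open>Invariant: the leading \<open>i - a\<close> of the \<open>n - a\<close> digits
    of \<open>y\<close> have been appended. The quotient is 0 at \<open>i = a\<close> because
    \<open>y < 2 ^ (n - a)\<close>, and equals \<open>y\<close> at \<open>i = n\<close>.\<close>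
  have "P i u = P a u * 2 ^ (i - a) + y div 2 ^ (n - i)" if "a \<le> i" "i \<le> n" for i
    using that
  proof (induction i rule: dec_induct)
    case base
    have "y < 2 ^ (n - a)" unfolding y_def a_def by (rule h)
    then show ?case by simp
  next
    case (step i)
    have bl: "block i = k"
      using step.hyps step.prems assms(2) by (intro block_eq) (auto simp: a_def n_def simp del: fact_Suc)
    then have st: "steered c i"
      using assms(1) step.hyps by (auto simp: steered_def a_def n_def simp del: fact_Suc)
    have "steer_rule c h i (P i u) = y div 2 ^ (n - Suc i) mod 2"
      using div[OF step.hyps(1)] st bl
      by (simp add: steer_rule_def Let_def y_def a_def n_def del: fact_Suc)
    then have "P (Suc i) u = 2 * P i u + y div 2 ^ (n - Suc i) mod 2"
      using st by (simp add: P_def steer_free_def)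
    also have "2 * P i u = P a u * 2 ^ (Suc i - a) + 2 * (y div 2 ^ (n - i))"
      using step by (simp add: Suc_diff_le)
    also have "y div 2 ^ (n - i) = y div 2 ^ (n - Suc i) div 2"
    proof -
      have "n - i = Suc (n - Suc i)" using step.prems by simp
      then show ?thesis by (simp only: power_Suc2 div_mult2_eq)
    qed
    also have "P a u * 2 ^ (Suc i - a) + 2 * (y div 2 ^ (n - Suc i) div 2) + y div 2 ^ (n - Suc i) mod 2 =
        P a u * 2 ^ (Suc i - a) + y div 2 ^ (n - Suc i)"
      by presburger
    finally show ?case .
  qed
  from this[of n] have "P n u = P a u * 2 ^ (n - a) + y"
    using \<open>a \<le> n\<close> by simp
  moreover have "y < 2 ^ (n - a)" unfolding y_def a_def by (rule h)
  ultimately have "P n u mod 2 ^ (n - a) = y" by simp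
  then show "P n u mod 2 ^ (n - steer_start c n) = h n (P n u div 2 ^ (n - steer_start c n))"
    using first by (simp add: y_def a_def)
qed

section \<open>The random selection\<close>

lemma dyad_eq_iff: "dyad n p = dyad n q \<longleftrightarrow> p = q"
proof
  assume "dyad n p = dyad n q"
  then have "Inf (dyad n p) = Inf (dyad n q)" by simp
  then show "p = q" by (simp add: dyad_def divide_right_mono)
qed simp

lemma dyadic_intervals_eq: "dyadic_intervals n = dyad n ` {..<2 ^ n}"
proof (intro equalityI subsetI)
  fix Q assume "Q \<in> dyadic_intervals n"
  then obtain k :: int where k: "Q = {of_int k / 2 ^ n .. (of_int k + 1) / 2 ^ n}" "0 \<le> k" "k \<le> 2 ^ n - 1"
    by (auto simp: dyadic_intervals_def)
  then have "Q = dyad n (nat k)" "nat k < 2 ^ n"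
    by (auto simp: dyad_def nat_less_iff)
  then show "Q \<in> dyad n ` {..<2 ^ n}" by auto
next
  fix Q assume "Q \<in> dyad n ` {..<2 ^ n}"
  then obtain p where p: "Q = dyad n p" "p < 2 ^ n" by auto
  have "int p < 2 ^ n" using p(2) by (metis of_nat_less_numeral_power_cancel_iff)
  then show "Q \<in> dyadic_intervals n"
    unfolding dyadic_intervals_def using p by (auto simp: dyad_def intro!: exI[of _ "int p"])
qed

lemma dyadic_intervals_nonempty: "dyadic_intervals n \<noteq> {}"
proof -
  have "dyad n 0 \<in> dyadic_intervals n"
    unfolding dyadic_intervals_eq by (rule imageI) simp
  then show ?thesis by blast
qed

lemma finite_dyadic_intervals: "finite (dyadic_intervals n)"
  by (simp add: dyadic_intervals_eq)

lemma bounded_dyad: "bounded (dyad n p)"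
  by (simp add: dyad_def)

lemma diameter_dyad: "diameter (dyad n p) = 1 / 2 ^ n"
proof -
  have "real p / 2 ^ n \<le> (real p + 1) / 2 ^ n"
    by (intro divide_right_mono) auto
  then show ?thesis
    by (simp add: dyad_def diff_divide_distrib[symmetric])
qed

text \<open>Taking \<open>frac\<close> keeps the index in range for every \<omega>, not just almost
  every one. The coordinate \<open>\<omega> x\<close> is reused at all orders \<open>n\<close>;
  independence matters only within one order, as the indices and the Correlation Condition never mix
  orders.\<close>

definition chosen :: "real \<Rightarrow> (nat \<Rightarrow> real) \<Rightarrow> nat \<Rightarrow> nat \<Rightarrow> nat" where
  "chosen c \<omega> n x = nat \<lfloor>frac (\<omega> x) * 2 ^ (n - steer_start c n)\<rfloor>"

text \<open>
  Among the intervals of order \<open>n\<close> inside the \<open>x\<close>-th interval of order \<open>steer_start c n\<close>, exactly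
  one is selected, namely the one with relative index \<open>chosen c \<omega> n x\<close>.
\<close>
definition selector :: "real \<Rightarrow> nat \<Rightarrow> real set \<Rightarrow> (nat \<Rightarrow> real) \<Rightarrow> real" where
  "selector c n Q \<omega> =
     (if \<exists>p. Q = dyad n p \<and> chosen c \<omega> n (p div 2 ^ (n - steer_start c n)) = p mod 2 ^ (n - steer_start c n)
      then 1 else 0)"

lemma selector_dyad:
  "selector c n (dyad n p) \<omega> =
     of_bool (chosen c \<omega> n (p div 2 ^ (n - steer_start c n)) = p mod 2 ^ (n - steer_start c n))"
  by (simp add: selector_def dyad_eq_iff)

lemma nat_floor_eq_iff_half_open:
  fixes x :: real
  assumes "0 \<le> x"
  shows "nat \<lfloor>x\<rfloor> = y \<longleftrightarrow> real y \<le> x \<and> x < real y + 1"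
  using assms by (auto simp: nat_eq_iff2 floor_eq_iff) linarith+

lemma chosen_less: "chosen c \<omega> n x < 2 ^ (n - steer_start c n)"
proof -
  let ?K = "2 ^ (n - steer_start c n)"
  have "frac (\<omega> x) * ?K < 1 * ?K"
    by (intro mult_strict_right_mono frac_lt_1) simp
  then have "\<lfloor>frac (\<omega> x) * ?K\<rfloor> < ?K"
    by (simp add: floor_less_iff)
  then show ?thesis
    by (simp add: chosen_def nat_less_iff)
qed

section \<open>The product space of uniform variables\<close>

definition unif :: "real measure" where
  "unif = uniform_measure lborel {0..<1}"

definition unif_seq :: "(nat \<Rightarrow> real) measure" where
  "unif_seq = PiM UNIV (\<lambda>_. unif)"

lemma prob_space_unif: "prob_space unif"
  unfolding unif_def by (rule prob_space_uniform_measure) auto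

lemma sets_unif [measurable_cong]: "sets unif = sets borel"
  by (simp add: unif_def)

interpretation unif_seq: product_prob_space "\<lambda>_::nat. unif" UNIV
  by (simp add: product_prob_space_def product_prob_space_axioms_def product_sigma_finite_def
      prob_space_unif prob_space_imp_sigma_finite)

lemma space_unif_seq: "space unif_seq = UNIV"
  by (simp add: unif_seq_def space_PiM unif_def)

lemma prob_space_unif_seq: "prob_space unif_seq"
  unfolding unif_seq_def by (rule unif_seq.P.prob_space_axioms)

definition digit_event :: "nat \<Rightarrow> nat \<Rightarrow> real set" where
  "digit_event K y = {u. nat \<lfloor>frac u * real K\<rfloor> = y}"

lemma digit_event_measurable [measurable]: "digit_event K y \<in> sets borel"
  unfolding digit_event_def frac_def by measurable

text \<open>On \<open>{0..<1}\<close>, which carries the measure, \<open>frac\<close> is the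
  identity and the event is a half-open interval of length 1/K.\<close>

lemma measure_digit_event:
  assumes "y < K"
  shows "measure unif (digit_event K y) = 1 / real K"
proof -
  have K: "0 < real K" using assms by simp
  have "{0..<1} \<inter> digit_event K y = {real y / real K ..< (real y + 1) / real K}"
  proof (intro equalityI subsetI)
    fix u assume "u \<in> {0..<1} \<inter> digit_event K y"
    moreover from this have "frac u = u" by (simp add: frac_eq)
    ultimately show "u \<in> {real y / real K ..< (real y + 1) / real K}"
      using K by (auto simp: digit_event_def nat_floor_eq_iff_half_open field_simps)
  next
    fix u assume u: "u \<in> {real y / real K ..< (real y + 1) / real K}"
    have "0 \<le> real y / real K" by simp
    moreover have "(real y + 1) / real K \<le> 1" using assms K by (simp add: divide_le_eq)
    ultimately have "u \<in> {0..<1}"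
      using u unfolding atLeastLessThan_iff by linarith
    moreover from this have "frac u = u" by (simp add: frac_eq)
    ultimately show "u \<in> {0..<1} \<inter> digit_event K y"
      using K u by (auto simp: digit_event_def nat_floor_eq_iff_half_open field_simps)
  qed
  then have "measure unif (digit_event K y) = measure lborel {real y / real K ..< (real y + 1) / real K}"
    unfolding unif_def by (subst measure_uniform_measure) (auto simp: Int_commute)
  also have "\<dots> = 1 / real K"
    using K by (simp add: diff_divide_distrib[symmetric] divide_right_mono)
  finally show ?thesis .
qed

lemma measure_unif_seq_cylinder:
  assumes "finite J" "\<And>i. i \<in> J \<Longrightarrow> X i \<in> sets borel"
  shows "measure unif_seq {\<omega>. \<forall>i\<in>J. \<omega> i \<in> X i} = (\<Prod>i\<in>J. measure unif (X i))"
proof -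
  have "prod_emb UNIV (\<lambda>_. unif) J (Pi\<^sub>E J X) = {\<omega>. \<forall>i\<in>J. \<omega> i \<in> X i}"
    by (auto simp: prod_emb_def PiE_iff unif_def)
  then show ?thesis
    using unif_seq.measure_PiM_emb[of J X] assms by (simp add: unif_seq_def sets_unif)
qed

lemma (in prob_space) covariance_indicator:
  assumes "A \<in> events" "B \<in> events"
  shows "covariance M (indicat_real A) (indicat_real B) = prob (A \<inter> B) - prob A * prob B"
proof -
  have [simp]: "(\<integral>x. indicat_real S x \<partial>M) = prob S" if "S \<in> events" for S
    using that sets.sets_into_space by (simp add: Int_absorb2)
  have int: "integrable M (indicat_real S)" if "S \<in> events" for S
    using that by (simp add: emeasure_eq_measure)
  have "covariance M (indicat_real A) (indicat_real B) =
      (\<integral>x. indicat_real (A \<inter> B) x - prob A * indicat_real B x - prob B * indicat_real A x + prob A * prob B \<partial>M)"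
    unfolding covariance_def using assms
    by (intro Bochner_Integration.integral_cong) (auto simp: indicator_inter_arith algebra_simps)
  also have "\<dots> = prob (A \<inter> B) - prob A * prob B - prob B * prob A + prob A * prob B"
    using assms int by (simp add: prob_space)
  finally show ?thesis by simp
qed

definition select_event :: "real \<Rightarrow> nat \<Rightarrow> nat \<Rightarrow> (nat \<Rightarrow> real) set" where
  "select_event c n p =
     {\<omega>. \<omega> (p div 2 ^ (n - steer_start c n)) \<in> digit_event (2 ^ (n - steer_start c n)) (p mod 2 ^ (n - steer_start c n))}"

lemma selector_eq_indicator: "selector c n (dyad n p) = indicat_real (select_event c n p)"
  by (auto simp: fun_eq_iff selector_dyad select_event_def digit_event_def chosen_def indicator_def)

lemma select_event_sets: "select_event c n p \<in> sets unif_seq"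
proof -
  have "{\<omega> \<in> space unif_seq. \<omega> (p div 2 ^ (n - steer_start c n)) \<in>
      digit_event (2 ^ (n - steer_start c n)) (p mod 2 ^ (n - steer_start c n))} \<in> sets unif_seq"
    unfolding unif_seq_def by measurable
  then show ?thesis by (simp add: select_event_def space_unif_seq)
qed

lemma measure_select_event: "measure unif_seq (select_event c n p) = 1 / 2 ^ (n - steer_start c n)"
  using measure_unif_seq_cylinder[of "{p div 2 ^ (n - steer_start c n)}"
      "\<lambda>_. digit_event (2 ^ (n - steer_start c n)) (p mod 2 ^ (n - steer_start c n))"]
  by (simp add: select_event_def measure_digit_event)

text \<open>Intervals with the same parent exclude each other; those with different parents depend
  on different coordinates and are independent.\<close>

lemma measure_select_event_Int:
  assumes "p \<noteq> q"
  shows "measure unif_seq (select_event c n p \<inter> select_event c n q)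
    \<le> measure unif_seq (select_event c n p) * measure unif_seq (select_event c n q)"
proof -
  define K :: nat where "K = 2 ^ (n - steer_start c n)"
  have K: "0 < K" by (simp add: K_def)
  show ?thesis
  proof (cases "p div K = q div K")
    case True
    then have "p mod K \<noteq> q mod K" using assms by (metis div_mult_mod_eq)
    then have "select_event c n p \<inter> select_event c n q = {}"
      using True by (auto simp: select_event_def digit_event_def simp flip: K_def)
    then show ?thesis by simp
  next
    case False
    define X where "X i = digit_event K (if i = p div K then p mod K else q mod K)" for i
    have "select_event c n p \<inter> select_event c n q = {\<omega>. \<forall>i\<in>{p div K, q div K}. \<omega> i \<in> X i}"
      using False by (auto simp: select_event_def X_def simp flip: K_def)
    then have "measure unif_seq (select_event c n p \<inter> select_event c n q) = (\<Prod>i\<in>{p div K, q div K}. measure unif (X i))"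
      by (simp only:) (rule measure_unif_seq_cylinder, auto simp: X_def)
    also have "\<dots> = 1 / real K * (1 / real K)"
      using False K by (simp add: X_def measure_digit_event)
    finally show ?thesis by (simp add: measure_select_event K_def)
  qed
qed

section \<open>Hitting probabilities, indices and covariances\<close>

lemma hit_prob_selector: "hit_prob unif_seq (selector c) n (dyad n p) = 1 / 2 ^ (n - steer_start c n)"
proof -
  have "{\<omega> \<in> space unif_seq. selector c n (dyad n p) \<omega> = 1} = select_event c n p"
    by (auto simp: selector_eq_indicator space_unif_seq indicator_def)
  then show ?thesis by (simp add: hit_prob_def measure_select_event)
qed

text \<open>With a single value per order, the maximum and minimum in the two indices
  coincide.\<close>

lemma hit_prob_image: "hit_prob unif_seq (selector c) n ` dyadic_intervals n = {1 / 2 ^ (n - steer_start c n)}"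
proof -
  have "hit_prob unif_seq (selector c) n ` dyadic_intervals n = (\<lambda>_. 1 / 2 ^ (n - steer_start c n)) ` dyadic_intervals n"
    by (rule image_cong) (auto simp: dyadic_intervals_eq hit_prob_selector)
  also have "\<dots> = {1 / 2 ^ (n - steer_start c n)}"
    using dyadic_intervals_nonempty[of n] by (simp add: image_constant_conv)
  finally show ?thesis .
qed

lemma steer_start_lim:
  assumes "0 \<le> c" "c \<le> 1"
  shows "(\<lambda>n. - real (n - steer_start c n) / real n) \<longlonglongrightarrow> c - 1"
proof (rule tendsto_sandwich)
  show "eventually (\<lambda>n. c - 1 \<le> - real (n - steer_start c n) / real n) sequentially"
    using eventually_gt_at_top[of 0]
  proof eventually_elim
    case (elim n)
    then show ?case
      using steer_start_ge[of c n] steer_start_le[OF assms(2), of n]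
      by (simp add: field_simps of_nat_diff)
  qed
  show "eventually (\<lambda>n. - real (n - steer_start c n) / real n \<le> c - 1 + 1 / real n) sequentially"
    using eventually_gt_at_top[of 0]
  proof eventually_elim
    case (elim n)
    then show ?case
      using steer_start_less[OF assms(1), of n] steer_start_le[OF assms(2), of n]
      by (simp add: field_simps of_nat_diff)
  qed
  show "(\<lambda>n. c - 1 + 1 / real n) \<longlonglongrightarrow> c - 1"
    using tendsto_add[OF tendsto_const lim_inverse_n', of "c - 1"] by simp
qed simp

lemma index_gamma_selector:
  assumes "0 \<le> c" "c \<le> 1"
  shows "index_gamma1 unif_seq (selector c) = ereal (1 - c)"
    and "index_gamma2 unif_seq (selector c) = ereal (1 - c)"
proof -
  have "limsup (\<lambda>n. elog2 (1 / 2 ^ (n - steer_start c n)) / ereal (real n)) = ereal (c - 1)"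
  proof (rule lim_imp_Limsup)
    have "eventually (\<lambda>n. ereal (- real (n - steer_start c n) / real n) =
        elog2 (1 / 2 ^ (n - steer_start c n)) / ereal (real n)) sequentially"
      using eventually_gt_at_top[of 0]
    proof eventually_elim
      case (elim n)
      have "\<not> (2 :: real) ^ (n - steer_start c n) \<le> 0"
        by (simp add: not_le)
      then show ?case
        using elim by (simp add: elog2_def log_divide)
    qed
    moreover have "(\<lambda>n. ereal (- real (n - steer_start c n) / real n)) \<longlonglongrightarrow> ereal (c - 1)"
      using steer_start_lim[OF assms] by simp
    ultimately show "(\<lambda>n. elog2 (1 / 2 ^ (n - steer_start c n)) / ereal (real n)) \<longlonglongrightarrow> ereal (c - 1)"
      by (rule Lim_transform_eventually[rotated])
  qed simp
  then show "index_gamma1 unif_seq (selector c) = ereal (1 - c)"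
    and "index_gamma2 unif_seq (selector c) = ereal (1 - c)"
    by (simp_all add: index_gamma1_def index_gamma2_def hit_prob_image)
qed

text \<open>Distinct intervals have covariance at most 0, whereas the threshold is positive, so at
  most \<open>Q\<close> itself is counted.\<close>

lemma correlation_condition_selector: "correlation_condition unif_seq (selector c) 0"
  unfolding correlation_condition_def
proof (intro allI impI)
  interpret prob_space unif_seq by (rule prob_space_unif_seq)
  fix \<epsilon> :: real assume \<epsilon>: "0 < \<epsilon>"
  have "elog2 (real (corr_count unif_seq (selector c) n \<epsilon>)) / ereal (real n) \<le> 0" if "0 < n" for n
  proof -
    have "card {Q' \<in> dyadic_intervals n. covariance unif_seq (selector c n Q) (selector c n Q') \<ge>
        \<epsilon> * hit_prob unif_seq (selector c) n Q * hit_prob unif_seq (selector c) n Q'} \<le> 1"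
      if Q: "Q \<in> dyadic_intervals n" for Q
    proof -
      have "Q' = Q" if Q': "Q' \<in> dyadic_intervals n"
        and cov: "covariance unif_seq (selector c n Q) (selector c n Q') \<ge>
          \<epsilon> * hit_prob unif_seq (selector c) n Q * hit_prob unif_seq (selector c) n Q'" for Q'
      proof (rule ccontr)
        assume "Q' \<noteq> Q"
        obtain p q where pq: "Q = dyad n p" "Q' = dyad n q"
          using Q Q' by (auto simp: dyadic_intervals_eq)
        then have "p \<noteq> q" using \<open>Q' \<noteq> Q\<close> by auto
        have "covariance unif_seq (selector c n Q) (selector c n Q') \<le> 0"
          using measure_select_event_Int[OF \<open>p \<noteq> q\<close>, of c n]
          by (simp add: pq selector_eq_indicator covariance_indicator select_event_sets)
        moreover have "0 < \<epsilon> * hit_prob unif_seq (selector c) n Q * hit_prob unif_seq (selector c) n Q'"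
          using \<epsilon> by (simp add: pq hit_prob_selector)
        ultimately show False using cov by linarith
      qed
      then have "{Q' \<in> dyadic_intervals n. covariance unif_seq (selector c n Q) (selector c n Q') \<ge>
        \<epsilon> * hit_prob unif_seq (selector c) n Q * hit_prob unif_seq (selector c) n Q'} \<subseteq> {Q}"
        by blast
      then show ?thesis
        using card_mono[of "{Q}"] by fastforce
    qed
    then have "corr_count unif_seq (selector c) n \<epsilon> \<le> 1"
      unfolding corr_count_def by (subst Max_le_iff) (auto simp: finite_dyadic_intervals dyadic_intervals_nonempty)
    \<comment> \<open>A count of 0, possible for instance when \<epsilon> is large, contributes
      -\<infinity> through \<open>elog2\<close>; a count of 1 contributes 0.\<close>
    then have "corr_count unif_seq (selector c) n \<epsilon> = 0 \<or> corr_count unif_seq (selector c) n \<epsilon> = 1"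
      by linarith
    then show ?thesis using that by (auto simp: elog2_def)
  qed
  then show "limsup (\<lambda>n. elog2 (real (corr_count unif_seq (selector c) n \<epsilon>)) / ereal (real n)) \<le> ereal 0"
    by (intro Limsup_bounded) (auto simp: zero_ereal_def[symmetric] intro: eventually_mono[OF eventually_gt_at_top[of 0]])
qed

lemma limsup_random_fractal_selector: "limsup_random_fractal unif_seq (selector c)"
proof -
  interpret prob_space unif_seq by (rule prob_space_unif_seq)
  show ?thesis
  proof
    fix n Q assume "Q \<in> dyadic_intervals n"
    then show "random_variable borel (selector c n Q)"
      by (auto simp: dyadic_intervals_eq selector_eq_indicator intro!: borel_measurable_indicator select_event_sets)
  qed (simp add: selector_def)
qed

section \<open>Dimensions of the limsup set and of its intersection with the digit set\<close>

lemma half_power_powr: "(1 / 2 ^ m :: real) powr s = 2 powr (- (s * real m))"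
proof -
  have "1 / 2 ^ m = (2 :: real) powr (- real m)"
    by (simp add: powr_minus_divide powr_realpow)
  then have "(1 / 2 ^ m :: real) powr s = 2 powr (- real m * s)"
    by (simp only: powr_powr)
  also have "- real m * s = - (s * real m)" by simp
  finally show ?thesis .
qed

text \<open>One interval per parent leaves at most \<open>2 ^ steer_start c n\<close> intervals of
  order \<open>n\<close>, which is less than \<open>2 powr (c * n + 1)\<close>; the covering series
  is geometric for \<open>c < s\<close>.\<close>

lemma hausdorff_dim_limsup_selector_le:
  assumes "0 \<le> c" "c \<le> 1"
  shows "hausdorff_dim (limsup_fractal (selector c) \<omega>) \<le> ereal c"
proof (rule hausdorff_dim_le[OF assms(1)])
  fix s assume s: "c < s"
  define K :: "nat \<Rightarrow> nat" where "K n = 2 ^ (n - steer_start c n)" for n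
  define T where "T n = {p. p < 2 ^ n \<and> chosen c \<omega> n (p div K n) = p mod K n}" for n
  have fin: "finite (T n)" for n by (simp add: T_def)
  have card: "card (T n) \<le> 2 ^ steer_start c n" for n
  proof -
    \<comment> \<open>The parent determines the remainder through \<open>chosen\<close>, hence the
      whole index.\<close>
    have "inj_on (\<lambda>p. p div K n) (T n)"
      by (intro inj_onI) (metis (mono_tags, lifting) T_def div_mult_mod_eq mem_Collect_eq)
    moreover have "(\<lambda>p. p div K n) ` T n \<subseteq> {..<2 ^ steer_start c n}"
    proof clarify
      fix p assume "p \<in> T n"
      then have "p < 2 ^ steer_start c n * K n"
        using steer_start_le[OF assms(2), of n] by (simp add: T_def K_def flip: power_add)
      then show "p div K n < 2 ^ steer_start c n"
        by (rule less_mult_imp_div_less)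
    qed
    ultimately show ?thesis
      using card_inj_on_le[of _ "T n" "{..<2 ^ steer_start c n :: nat}"] by simp
  qed
  show "hausdorff_measure s (limsup_fractal (selector c) \<omega>) = 0"
  proof (rule hausdorff_measure_limsup_cover[where V = dyad and T = T and r = "\<lambda>n. 1 / 2 ^ n"])
    fix k
    show "limsup_fractal (selector c) \<omega> \<subseteq> (\<Union>n\<in>{k..}. \<Union>p\<in>T n. dyad n p)"
    proof
      fix x assume "x \<in> limsup_fractal (selector c) \<omega>"
      then have "x \<in> (\<Union>n\<in>{max k 1..}. fractal_level (selector c) n \<omega>)"
        unfolding limsup_fractal_def by (rule INT_D) simp
      then obtain n where n: "k \<le> n" "x \<in> fractal_level (selector c) n \<omega>"
        by auto
      then obtain Q where Q: "Q \<in> dyadic_intervals n" "selector c n Q \<omega> = 1" "x \<in> Q"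
        unfolding fractal_level_def by blast
      then obtain p where "p < 2 ^ n" "Q = dyad n p"
        by (auto simp: dyadic_intervals_eq)
      with Q have "p \<in> T n" "x \<in> dyad n p"
        by (auto simp: T_def K_def selector_dyad)
      with n(1) show "x \<in> (\<Union>n\<in>{k..}. \<Union>p\<in>T n. dyad n p)" by auto
    qed
  next
    show "(\<lambda>n. 1 / 2 ^ n :: real) \<longlonglongrightarrow> 0"
      using LIMSEQ_realpow_zero[of "1 / 2"] by (simp add: power_one_over)
  next
    show "summable (\<lambda>n. card (T n) * (1 / 2 ^ n :: real) powr s)"
    proof (rule summable_comparison_test')
      have "2 powr (c - s) < 1"
        using s powr_less_cancel_iff[of 2 "c - s" 0] by simp
      then show "summable (\<lambda>n. 2 * (2 powr (c - s)) ^ n)"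
        by (intro summable_mult summable_geometric) simp
      fix n :: nat assume "0 \<le> n"
      have "real (card (T n)) \<le> 2 ^ steer_start c n"
        using card[of n] by (metis of_nat_le_iff of_nat_numeral of_nat_power)
      also have "\<dots> = 2 powr real (steer_start c n)"
        by (simp add: powr_realpow)
      also have "\<dots> \<le> 2 powr (c * real n + 1)"
        using steer_start_less[OF assms(1), of n] by (intro powr_mono) auto
      finally have "card (T n) * (1 / 2 ^ n) powr s \<le> 2 powr (c * real n + 1) * 2 powr (- (s * real n))"
        unfolding half_power_powr by (rule mult_right_mono) simp
      also have "\<dots> = 2 powr ((c - s) * real n + 1)"
        unfolding powr_add[symmetric] by (rule arg_cong[where f = "(powr) 2"]) (simp add: algebra_simps)
      also have "\<dots> = 2 * (2 powr (c - s)) ^ n"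
      proof -
        have "(2 powr (c - s)) ^ n = 2 powr ((c - s) * real n)"
          by (simp add: powr_realpow[symmetric] powr_powr)
        then show ?thesis
          unfolding powr_add by simp
      qed
      finally show "norm (card (T n) * (1 / 2 ^ n) powr s) \<le> 2 * (2 powr (c - s)) ^ n"
        by simp
    qed
  qed (use assms s in \<open>auto simp: fin bounded_dyad diameter_dyad\<close>)
qed

text \<open>Covers are taken only at the ends of odd blocks, where free digits are scarcest.\<close>

lemma hausdorff_dim_sparse_le:
  assumes "0 \<le> t"
  shows "hausdorff_dim (digit_set (sparse_free t)) \<le> ereal t"
proof (rule hausdorff_dim_le[OF assms])
  fix s assume s: "t < s"
  \<comment> \<open>The end of block \<open>2 * n + 1\<close>, which is odd.\<close>
  define \<nu> :: "nat \<Rightarrow> nat" where "\<nu> n = fact (2 * n + 2)" for n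
  have \<nu>: "n \<le> \<nu> n" for n
    using fact_ge_self[of "2 * n + 2"] unfolding \<nu>_def by linarith
  show "hausdorff_measure s (digit_set (sparse_free t)) = 0"
  proof (rule hausdorff_measure_limsup_cover[where V = "\<lambda>n. dyad (\<nu> n)"
        and T = "\<lambda>n. digit_tree (sparse_free t) (\<nu> n)" and r = "\<lambda>n. 1 / 2 ^ \<nu> n"])
    fix k
    show "digit_set (sparse_free t) \<subseteq> (\<Union>n\<in>{k..}. \<Union>p\<in>digit_tree (sparse_free t) (\<nu> n). dyad (\<nu> n) p)"
      unfolding digit_set_def by fastforce
  next
    have lim: "(\<lambda>n. 1 / 2 ^ n :: real) \<longlonglongrightarrow> 0"
      using LIMSEQ_realpow_zero[of "1 / 2"] by (simp add: power_one_over)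
    have "1 / 2 ^ \<nu> n \<le> (1 / 2 ^ n :: real)" for n
      by (intro divide_left_mono power_increasing \<nu>) auto
    then show "(\<lambda>n. 1 / 2 ^ \<nu> n :: real) \<longlonglongrightarrow> 0"
      by (intro tendsto_sandwich[OF _ _ tendsto_const lim]) auto
  next
    \<comment> \<open>Half of the slack absorbs the digits before the block; the other half makes
      the series converge.\<close>
    define \<eta> where "\<eta> = (s - t) / 2"
    have \<eta>: "0 < \<eta>" using s by (simp add: \<eta>_def)
    obtain K :: nat where K: "1 / \<eta> \<le> real K"
      using real_arch_simple by blast
    show "summable (\<lambda>n. card (digit_tree (sparse_free t) (\<nu> n)) * (1 / 2 ^ \<nu> n :: real) powr s)"
    proof (rule summable_comparison_test')
      have "2 powr (- \<eta>) < 1"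
        using \<eta> powr_less_cancel_iff[of 2 "- \<eta>" 0] by simp
      then show "summable (\<lambda>n. (2 powr (- \<eta>)) ^ n)"
        by (intro summable_geometric) simp
      fix n assume "K \<le> n"
      then have "1 / \<eta> \<le> real (2 * n + 2)" using K by linarith
      then have "1 \<le> \<eta> * real (2 * n + 2)"
        using \<eta> by (simp add: pos_divide_le_eq mult.commute)
      then have "1 * fact (2 * n + 1) \<le> \<eta> * real (2 * n + 2) * fact (2 * n + 1)"
        by (rule mult_right_mono) simp
      also have "\<dots> = \<eta> * real (\<nu> n)"
        by (simp add: \<nu>_def algebra_simps)
      finally have small: "fact (2 * n + 1) \<le> \<eta> * real (\<nu> n)" by simp
      have "real (free_count (sparse_free t) (\<nu> n)) \<le> fact (2 * n + 1) + t * real (\<nu> n)"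
        using free_count_sparse_le[of "2 * n + 1" t] assms by (simp add: \<nu>_def del: fact_Suc)
      also have "\<dots> \<le> (s - \<eta>) * real (\<nu> n)"
        using small by (simp add: \<eta>_def field_simps)
      finally have count: "real (free_count (sparse_free t) (\<nu> n)) \<le> (s - \<eta>) * real (\<nu> n)" .
      have "real (card (digit_tree (sparse_free t) (\<nu> n))) \<le> 2 ^ free_count (sparse_free t) (\<nu> n)"
        using card_digit_tree[of "sparse_free t" "\<nu> n"] by (metis of_nat_le_iff of_nat_numeral of_nat_power)
      also have "\<dots> = 2 powr real (free_count (sparse_free t) (\<nu> n))"
        by (simp add: powr_realpow)
      also have "\<dots> \<le> 2 powr ((s - \<eta>) * real (\<nu> n))"
        using count by (intro powr_mono) auto
      finally have "card (digit_tree (sparse_free t) (\<nu> n)) * (1 / 2 ^ \<nu> n) powr s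
          \<le> 2 powr ((s - \<eta>) * real (\<nu> n)) * 2 powr (- (s * real (\<nu> n)))"
        unfolding half_power_powr by (rule mult_right_mono) simp
      also have "\<dots> = 2 powr (- \<eta> * real (\<nu> n))"
        by (simp add: powr_add[symmetric] algebra_simps)
      also have "\<dots> \<le> 2 powr (- \<eta> * real n)"
        using \<nu>[of n] \<eta> by (intro powr_mono) auto
      also have "\<dots> = (2 powr (- \<eta>)) ^ n"
        by (simp add: powr_realpow[symmetric] powr_powr)
      finally show "norm (card (digit_tree (sparse_free t) (\<nu> n)) * (1 / 2 ^ \<nu> n) powr s) \<le> (2 powr (- \<eta>)) ^ n"
        unfolding real_norm_def abs_of_nonneg[OF mult_nonneg_nonneg[OF of_nat_0_le_iff powr_ge_zero]] .
    qed
  qed (use assms s in \<open>auto simp: bounded_dyad diameter_dyad\<close>)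
qed

text \<open>At the ends of even blocks almost all digits are free, so \<open>growth\<close> holds
  for every \<open>s < 1\<close>; all other digits are set to 0.\<close>

lemma packing_dim_sparse: "packing_dim (digit_set (sparse_free t)) = 1"
proof (rule antisym)
  show "packing_dim (digit_set (sparse_free t)) \<le> 1"
    by (rule packing_dim_le_1) (rule digit_set_subset)
  interpret digit_scheme "sparse_free t" "\<lambda>_ _. 0" by standard simp
  have "ereal 1 \<le> packing_dim (digit_set (sparse_free t))"
  proof (rule packing_dim_ge)
    fix s :: real assume s: "0 \<le> s" "s < 1"
    show "packing_measure s (digit_set (sparse_free t)) \<noteq> 0"
    proof (rule packing_measure_point_image)
      fix e :: real and J :: nat assume "0 < e"
      obtain k1 :: nat where k1: "2 / (1 - s) \<le> real k1"
        using real_arch_simple by blast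
      obtain k2 where k2: "(1 / 2) ^ k2 < e"
        using real_arch_pow_inv[OF \<open>0 < e\<close>, of "1 / 2"] by auto
      \<comment> \<open>An even block index: \<open>k1\<close> gives
        \<open>2 * fact k \<le> (1 - s) * fact (Suc k)\<close>, \<open>k2\<close> makes
        \<open>2^-(fact k)\<close> smaller than \<open>e\<close>, and \<open>J\<close> makes the
        order late enough.\<close>
      define k where "k = 2 * (k1 + k2 + J)"
      have "2 / (1 - s) \<le> real (Suc k)" using k1 by (simp add: k_def)
      then have "2 \<le> (1 - s) * real (Suc k)"
        using s by (simp add: pos_divide_le_eq mult.commute)
      then have "2 * fact k \<le> (1 - s) * real (Suc k) * fact k"
        by (rule mult_right_mono) simp
      also have "\<dots> = (1 - s) * real (fact (Suc k))"
        by (simp add: algebra_simps)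
      finally have 1: "2 * fact k \<le> (1 - s) * real (fact (Suc k))" .
      have "fact (Suc k) \<le> N (fact (Suc k)) + fact k"
        using free_count_sparse_ge[of k t] by (simp add: k_def del: fact_Suc)
      then have "real (fact (Suc k)) \<le> real (N (fact (Suc k))) + real (fact k)"
        by linarith
      then have 2: "s * real (fact (Suc k)) - real (N (fact (Suc k))) \<le> - fact k"
        using 1 by (simp add: algebra_simps del: fact_Suc)
      have "k2 \<le> fact k"
        using fact_ge_self[of k] by (simp add: k_def)
      then have "real k2 \<le> fact k"
        by (metis of_nat_fact of_nat_mono)
      with 2 have "2 powr (s * real (fact (Suc k)) - real (N (fact (Suc k)))) \<le> 2 powr (- real k2)"
        by (intro powr_mono) auto
      also have "\<dots> = (1 / 2) ^ k2"
        by (simp add: powr_minus_divide powr_realpow power_one_over)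
      also note k2
      finally have "2 powr (s * real (fact (Suc k)) - real (N (fact (Suc k)))) < e" .
      moreover have "J \<le> fact (Suc k)"
        using fact_ge_self[of "Suc k"] by (rule order_trans[rotated]) (simp add: k_def)
      ultimately show "\<exists>j\<ge>J. 2 powr (s * real j - real (N j)) < e" by blast
    next
      show "\<phi> ` {0..<1} \<subseteq> digit_set (sparse_free t)"
        using point_in_digit_set by auto
    qed (use s in simp)
  qed
  then show "1 \<le> packing_dim (digit_set (sparse_free t))"
    by (simp add: one_ereal_def)
qed

section \<open>Steered points and the lower bounds\<close>

text \<open>Steering acts only in even blocks, where the digit set imposes no restriction.\<close>

lemma steered_point_in_sparse:
  "digit_point (steer_free c t) (steer_rule c h) u \<in> digit_set (sparse_free t)"
  by (rule digit_scheme.point_in_digit_set[OF digit_scheme_steer])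
    (auto simp: steer_free_def steer_rule_def sparse_free_def steered_def)

text \<open>For every large even \<open>k\<close> steering starts inside block \<open>k\<close>, so
  the point lies in a selected interval of order \<open>fact (Suc k)\<close>; this gives infinitely
  many orders.\<close>

lemma steered_point_in_limsup_fractal:
  assumes "0 < c" "c \<le> 1"
  shows "digit_point (steer_free c t) (steer_rule c (chosen c \<omega>)) u \<in> limsup_fractal (selector c) \<omega>"
  unfolding limsup_fractal_def
proof
  fix m :: nat
  let ?P = "digit_prefix (steer_free c t) (steer_rule c (chosen c \<omega>))"
  let ?x = "digit_point (steer_free c t) (steer_rule c (chosen c \<omega>)) u"
  obtain k1 :: nat where k1: "1 / c \<le> real k1"
    using real_arch_simple by blast
  define k where "k = 2 * (k1 + m)"
  define n :: nat where "n = fact (Suc k)"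
  have "1 / c \<le> real (Suc k)" using k1 by (simp add: k_def)
  then have "1 \<le> c * real (Suc k)"
    using assms by (simp add: pos_divide_le_eq mult.commute)
  then have "1 * real (fact k) \<le> c * real (Suc k) * real (fact k)"
    by (rule mult_right_mono) simp
  also have "\<dots> = c * real (fact (Suc k))" by (simp add: algebra_simps)
  also have "\<dots> \<le> real (steer_start c (fact (Suc k)))" by (rule steer_start_ge)
  finally have "fact k \<le> steer_start c (fact (Suc k))"
    by (simp only: mult_1 of_nat_le_iff)
  then have "selector c n (dyad n (?P n u)) \<omega> = 1"
    using steered_prefix(2)[of k c "chosen c \<omega>" t u] assms chosen_less
    by (simp add: selector_dyad n_def k_def del: fact_Suc)
  moreover have "?P n u < 2 ^ n"
    by (rule digit_scheme.prefix_less[OF digit_scheme_steer])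
  then have "dyad n (?P n u) \<in> dyadic_intervals n"
    by (simp add: dyadic_intervals_eq)
  moreover have "?x \<in> dyad n (?P n u)"
    by (rule digit_scheme.point_in_dyad[OF digit_scheme_steer])
  ultimately have "?x \<in> fractal_level (selector c) n \<omega>"
    unfolding fractal_level_def by blast
  moreover have "Suc k \<le> n"
    unfolding n_def by (rule fact_ge_self)
  then have "m \<le> n" by (simp add: k_def)
  ultimately show "?x \<in> (\<Union>n\<in>{m..}. fractal_level (selector c) n \<omega>)"
    by auto
qed

text \<open>A nonnegative \<open>s\<close> below \<open>min t c\<close> forces \<open>0 < c\<close>,
  so \<open>E\<close> is available whenever there is something to prove.\<close>

lemma hausdorff_dim_steered_ge:
  assumes "c \<le> 1" "t \<le> 1"
    and E: "0 < c \<Longrightarrow> digit_point (steer_free c t) (steer_rule c h) ` {0..<1} \<subseteq> E"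
  shows "ereal (min t c) \<le> hausdorff_dim E"
proof (rule hausdorff_dim_ge)
  fix s assume s: "0 \<le> s" "s < min t c"
  \<comment> \<open>The midpoint leaves room on both sides: below \<open>t\<close> and
    \<open>c\<close> for the digit count, and strictly above \<open>s\<close> so that vanishing
    measure at \<open>s\<close> is contradicted.\<close>
  define s' where "s' = (s + min t c) / 2"
  have s': "s < s'" "0 < s'" "s' < t" "s' < c"
    using s by (auto simp: s'_def)
  obtain C where "\<And>j. s' * real j - C \<le> real (free_count (steer_free c t) j)"
    using free_count_steer_ge[OF s'(2-4) assms(1,2)] by blast
  then have "ereal s' \<le> hausdorff_dim E"
    using s' E by (intro digit_scheme.hausdorff_dim_point_image[OF digit_scheme_steer]) auto
  moreover have "hausdorff_dim E \<le> ereal s" if "hausdorff_measure s E = 0"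
    unfolding hausdorff_dim_def using that s by (intro Inf_lower) auto
  ultimately show "hausdorff_measure s E \<noteq> 0"
    using s' by (meson ereal_less_eq(3) leD order_trans)
qed

text \<open>The lower bound is the case \<open>c = 1\<close>: \<open>steer_start 1 n\<close> is
  \<open>n\<close>, so no position is steered and the target function is irrelevant.\<close>

lemma hausdorff_dim_sparse:
  assumes "0 \<le> t" "t \<le> 1"
  shows "hausdorff_dim (digit_set (sparse_free t)) = ereal t"
proof (rule antisym)
  have "ereal (min t 1) \<le> hausdorff_dim (digit_set (sparse_free t))"
    by (rule hausdorff_dim_steered_ge[where h = "\<lambda>_ _. 0"]) (use assms steered_point_in_sparse in auto)
  then show "ereal t \<le> hausdorff_dim (digit_set (sparse_free t))"
    using assms by simp
qed (rule hausdorff_dim_sparse_le[OF assms(1)])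

lemma hausdorff_dim_limsup_Int_sparse:
  assumes "0 \<le> c" "c \<le> 1" "0 \<le> t" "t \<le> 1"
  shows "hausdorff_dim (limsup_fractal (selector c) \<omega> \<inter> digit_set (sparse_free t)) = ereal (min t c)"
proof (rule antisym)
  let ?E = "limsup_fractal (selector c) \<omega> \<inter> digit_set (sparse_free t)"
  have "hausdorff_dim ?E \<le> ereal c"
    using hausdorff_dim_mono[of ?E "limsup_fractal (selector c) \<omega>"]
      hausdorff_dim_limsup_selector_le[OF assms(1,2), of \<omega>] by auto
  moreover have "hausdorff_dim ?E \<le> ereal t"
    using hausdorff_dim_mono[of ?E "digit_set (sparse_free t)"] hausdorff_dim_sparse_le[OF assms(3)] by auto
  ultimately show "hausdorff_dim ?E \<le> ereal (min t c)"
    by (simp add: min_def)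
  show "ereal (min t c) \<le> hausdorff_dim ?E"
    by (rule hausdorff_dim_steered_ge[where h = "chosen c \<omega>"])
      (use assms steered_point_in_sparse steered_point_in_limsup_fractal in auto)
qed

theorem proposition1p2:
  fixes \<gamma>\<^sub>0 t :: real
  assumes "\<gamma>\<^sub>0 \<in> {0..1}" and "t \<in> {0..1}"
  shows "\<exists>(G :: real set) (M :: (nat \<Rightarrow> real) measure) Z.
           closed G \<and> G \<subseteq> {0..1} \<and> hausdorff_dim G = ereal t \<and> packing_dim G = 1 \<and>
           limsup_random_fractal M Z \<and>
           index_gamma1 M Z = ereal \<gamma>\<^sub>0 \<and> index_gamma2 M Z = ereal \<gamma>\<^sub>0 \<and>
           correlation_condition M Z 0 \<and>
           (AE \<omega> in M. hausdorff_dim (limsup_fractal Z \<omega> \<inter> G) = ereal (min t (1 - \<gamma>\<^sub>0)))"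
proof (intro exI conjI AE_I2)
  let ?c = "1 - \<gamma>\<^sub>0"
  show "index_gamma1 unif_seq (selector ?c) = ereal \<gamma>\<^sub>0" "index_gamma2 unif_seq (selector ?c) = ereal \<gamma>\<^sub>0"
    using assms index_gamma_selector[of ?c] by auto
  show "hausdorff_dim (limsup_fractal (selector ?c) \<omega> \<inter> digit_set (sparse_free t)) = ereal (min t ?c)" for \<omega>
    using assms by (intro hausdorff_dim_limsup_Int_sparse) auto
  show "hausdorff_dim (digit_set (sparse_free t)) = ereal t"
    using assms by (intro hausdorff_dim_sparse) auto
qed (rule closed_digit_set digit_set_subset packing_dim_sparse limsup_random_fractal_selector
    correlation_condition_selector)+

end
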